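(* Consider the sparse linear regression model $y=X\beta+w$ with $\beta\sim\mathcal{P}_{\|\beta\|_2}(\mathcal{D})$. Let $\epsilon\in(0,1)$ and define $\hat\beta\in\{-1,0,1\}^p$ by $$\hat\beta_j=\mathbf{1}\left\{\left|\frac{\langle X_j,y\rangle}{\|y\|_2}\right|\ge\sqrt{2(1+\epsilon/2)\log(2p)}\right\}\,\mathrm{sign}\!\left(\frac{\langle X_j,y\rangle}{\|y\|_2}\right),\qquad j\in[p].$$ Then for $$n\;\ge\;\frac{8(1+\epsilon)}{\beta_{\min}^2}\,\|\beta\|_2^2\,\frac{\mathrm{SNR}+1}{\mathrm{SNR}}\,\log(2p),$$ the vector $\hat\beta$ equals the signed support of $\beta$ with probability at least $$1-\left(\frac kp+2ke^{-c_2n}+\frac1{p^{c_2}}\right)$$ for some constant $c_2>0$.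
   Context: **Scaling regime.** $p\to\infty$, $n\to\infty$, $k=o(p)$, $n=\omega(k)$. **Model.** $X\in\mathbb{R}^{n\times p}$ has i.i.d. $\mathcal{N}(0,1)$ entries with columns $X_j$, $w\in\mathbb{R}^n$ has i.i.d. $\mathcal{N}(0,\sigma^2)$ entries, and $X,w,\beta$ are independent. $\mathrm{SNR}:=\|\beta\|_2^2/\sigma^2$. **Signal prior.** For $\mathcal{D}\subseteq\mathbb{R}$, $\beta\sim\mathcal{P}_{\|\beta\|_2}(\mathcal{D})$ means that $\beta$ is uniform over $k$-sparse vectors of $\mathbb{R}^p$ (exactly $k$ nonzero entries) whose nonzero entries lie in $\mathcal{D}$ and which have a fixed Euclidean norm, denoted $\|\beta\|_2$. It is assumed that $\beta_{\min}:=\min\{|b|:b\in\mathcal{D}\}>0$. $\mathrm{sign}(x)$ equals $1$ for $x>0$, $-1$ for $x<0$ and $0$ for $x=0$. The signed support of $\beta$ is the vector $(\mathrm{sign}(\beta_j))_{j\in[p]}$. *)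

theory Defs
  imports "HOL-Probability.Probability" "HOL-Library.Landau_Symbols"
begin

text \<open>
  Vectors of \<open>\<real>\<^sup>p\<close> are functions \<open>nat \<Rightarrow> real\<close> on the index set \<open>{..<p}\<close> (extensional outside it), so
  that the dimensions can vary along a sequence. An \<open>n \<times> p\<close> matrix is a function on
  \<open>{..<n} \<times> {..<p}\<close>, with entry \<open>X (i, j)\<close> in row \<open>i\<close> and column \<open>j\<close>.
\<close>

abbreviation l2 :: "nat \<Rightarrow> (nat \<Rightarrow> real) \<Rightarrow> real"
  where "l2 d x \<equiv> L2_set x {..<d}"

subsection \<open>Hausdorff measure on \<open>\<real>\<^sup>p\<close>\<close>

definition ediam :: "nat \<Rightarrow> (nat \<Rightarrow> real) set \<Rightarrow> ennreal"
  where "ediam p U = (SUP x\<in>U. SUP y\<in>U. ennreal (l2 p (\<lambda>j. x j - y j)))"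

text \<open>
  The term \<open>(diam U)\<^sup>s\<close> with the usual convention that, for \<open>s = 0\<close>, every nonempty set has
  weight 1. It is only used for sets of finite diameter.
\<close>

definition diam_weight :: "real \<Rightarrow> nat \<Rightarrow> (nat \<Rightarrow> real) set \<Rightarrow> ennreal"
  where "diam_weight s p U =
    (if U = {} then 0 else if s = 0 then 1 else ennreal (enn2real (ediam p U) powr s))"

definition hausdorff_pre :: "real \<Rightarrow> nat \<Rightarrow> real \<Rightarrow> (nat \<Rightarrow> real) set \<Rightarrow> ennreal"
  where "hausdorff_pre s p \<delta> A =
    (INF U\<in>{U :: nat \<Rightarrow> (nat \<Rightarrow> real) set. A \<subseteq> (\<Union>i. U i) \<and> (\<forall>i. ediam p (U i) \<le> ennreal \<delta>)}.
       \<Sum>i. diam_weight s p (U i))"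

definition hausdorff :: "real \<Rightarrow> nat \<Rightarrow> (nat \<Rightarrow> real) set \<Rightarrow> ennreal"
  where "hausdorff s p A = (SUP \<delta>\<in>{0<..}. hausdorff_pre s p \<delta> A)"

text \<open>
  The uniform distribution on \<open>S \<subseteq> \<real>\<^sup>p\<close>: normalised \<open>s\<close>-dimensional Hausdorff measure on \<open>S\<close>, where
  \<open>s\<close> is the (necessarily unique) exponent for which the total mass is positive and finite. For
  finite \<open>S\<close> this is \<open>s = 0\<close>, i.e. normalised counting measure; for pieces of a sphere it is
  normalised surface measure. If there is no such \<open>s\<close> (e.g. \<open>S = {}\<close>), no distribution is uniform
  on \<open>S\<close>.
\<close>

definition uniform_distribution_on :: "nat \<Rightarrow> (nat \<Rightarrow> real) set \<Rightarrow> (nat \<Rightarrow> real) measure \<Rightarrow> bool"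
  where "uniform_distribution_on p S P \<longleftrightarrow>
    sets P = sets (Pi\<^sub>M {..<p} (\<lambda>_. borel)) \<and>
    (\<exists>s\<ge>0. 0 < hausdorff s p S \<and> hausdorff s p S < \<infinity> \<and>
       (\<forall>A\<in>sets P. emeasure P A = hausdorff s p (A \<inter> S) / hausdorff s p S))"

subsection \<open>The sparse linear regression model\<close>

definition beta_min :: "real set \<Rightarrow> real"
  where "beta_min D = Inf (abs ` D)"

definition sparse_signals :: "nat \<Rightarrow> nat \<Rightarrow> real set \<Rightarrow> real \<Rightarrow> (nat \<Rightarrow> real) set"
  where "sparse_signals p k D r =
    {b \<in> {..<p} \<rightarrow>\<^sub>E UNIV.
       card {j. j < p \<and> b j \<noteq> 0} = k \<and> (\<forall>j<p. b j \<noteq> 0 \<longrightarrow> b j \<in> D) \<and> l2 p b = r}"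

text \<open>
  \<open>signal_prior p k D r P\<close> says that \<open>P\<close> is the prior of a \<open>k\<close>-sparse signal in \<open>\<real>\<^sup>p\<close> with nonzero
  entries in \<open>D\<close> and fixed Euclidean norm \<open>r\<close>.
\<close>

definition signal_prior :: "nat \<Rightarrow> nat \<Rightarrow> real set \<Rightarrow> real \<Rightarrow> (nat \<Rightarrow> real) measure \<Rightarrow> bool"
  where "signal_prior p k D r P \<longleftrightarrow> uniform_distribution_on p (sparse_signals p k D r) P"

definition gaussian :: "real \<Rightarrow> real measure"
  where "gaussian \<sigma> = density lborel (\<lambda>x. ennreal (normal_density 0 \<sigma> x))"

text \<open>The joint law of the triple \<open>(X, w, \<beta>)\<close> of independent components.\<close>

definition model ::
  "nat \<Rightarrow> nat \<Rightarrow> real \<Rightarrow> (nat \<Rightarrow> real) measure \<Rightarrow>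
     ((nat \<times> nat \<Rightarrow> real) \<times> (nat \<Rightarrow> real) \<times> (nat \<Rightarrow> real)) measure"
  where "model n p \<sigma> P =
    Pi\<^sub>M ({..<n} \<times> {..<p}) (\<lambda>_. gaussian 1) \<Otimes>\<^sub>M (Pi\<^sub>M {..<n} (\<lambda>_. gaussian \<sigma>) \<Otimes>\<^sub>M P)"

definition response ::
  "nat \<Rightarrow> (nat \<times> nat \<Rightarrow> real) \<Rightarrow> (nat \<Rightarrow> real) \<Rightarrow> (nat \<Rightarrow> real) \<Rightarrow> nat \<Rightarrow> real"
  where "response p X w b i = (\<Sum>j<p. X (i, j) * b j) + w i"

definition SNR :: "real \<Rightarrow> real \<Rightarrow> real"
  where "SNR r \<sigma> = r\<^sup>2 / \<sigma>\<^sup>2"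

definition correlation :: "nat \<Rightarrow> (nat \<times> nat \<Rightarrow> real) \<Rightarrow> (nat \<Rightarrow> real) \<Rightarrow> nat \<Rightarrow> real"
  where "correlation n X y j = (\<Sum>i<n. X (i, j) * y i) / l2 n y"

definition beta_hat ::
  "real \<Rightarrow> nat \<Rightarrow> nat \<Rightarrow> (nat \<times> nat \<Rightarrow> real) \<Rightarrow> (nat \<Rightarrow> real) \<Rightarrow> nat \<Rightarrow> real"
  where "beta_hat \<epsilon> n p X y j =
    (if \<bar>correlation n X y j\<bar> \<ge> sqrt (2 * (1 + \<epsilon> / 2) * ln (2 * real p)) then 1 else 0)
      * sgn (correlation n X y j)"

definition recovers_signed_support ::
  "real \<Rightarrow> nat \<Rightarrow> nat \<Rightarrow> (nat \<times> nat \<Rightarrow> real) \<Rightarrow> (nat \<Rightarrow> real) \<Rightarrow> (nat \<Rightarrow> real) \<Rightarrow> bool"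
  where "recovers_signed_support \<epsilon> n p X w b \<longleftrightarrow>
    (\<forall>j<p. beta_hat \<epsilon> n p X (response p X w b) j = sgn (b j))"

definition scaling_regime :: "(nat \<Rightarrow> nat) \<Rightarrow> (nat \<Rightarrow> nat) \<Rightarrow> (nat \<Rightarrow> nat) \<Rightarrow> bool"
  where "scaling_regime n p k \<longleftrightarrow>
    filterlim p at_top sequentially \<and> filterlim n at_top sequentially \<and>
    (\<lambda>m. real (k m)) \<in> o(\<lambda>m. real (p m)) \<and>
    (\<lambda>m. real (n m)) \<in> \<omega>(\<lambda>m. real (k m))"

end

theory Submission
  imports Defs
begin

text \<open>
  Fix the signal \<open>b\<close> and put \<open>s\<^sup>2 = \<sigma>\<^sup>2 + \<parallel>b\<parallel>\<^sup>2\<close>. The response \<open>y\<close> has i.i.d. \<open>N(0, s\<^sup>2)\<close> entries, and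
  regressing the column \<open>X\<^sub>j\<close> on \<open>y\<close> gives \<open>X\<^sub>j = z + (b\<^sub>j / s\<^sup>2) y\<close> with \<open>z\<close> independent of \<open>y\<close>
  and with Gaussian entries of variance at most 1. Hence the correlation is
  \<open>\<langle>z, y\<rangle> / \<parallel>y\<parallel> + (b\<^sub>j / s\<^sup>2) \<parallel>y\<parallel>\<close>, where the first summand is subgaussian given \<open>y\<close>. For \<open>b\<^sub>j = 0\<close> it stays
  below the threshold \<open>t\<close>. For \<open>b\<^sub>j \<noteq> 0\<close> the second summand is at least \<open>2 t\<close> in absolute value unless
  \<open>\<parallel>y\<parallel>\<^sup>2 < q s\<^sup>2 n\<close> with \<open>q = (1 + \<epsilon>/2) / (1 + \<epsilon>) < 1\<close>, which is exponentially unlikely. A union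
  bound over the columns and Fubini over the signal conclude.
\<close>

subsection \<open>Gaussian measures\<close>

lemma space_gaussian [simp]: "space (gaussian \<sigma>) = UNIV"
  and sets_gaussian [simp, measurable_cong]: "sets (gaussian \<sigma>) = sets borel"
  by (simp_all add: gaussian_def)

lemma prob_space_gaussian: "\<sigma> > 0 \<Longrightarrow> prob_space (gaussian \<sigma>)"
  unfolding gaussian_def by (rule prob_space_normal_density)

lemma nn_integral_gaussian:
  fixes f :: "real \<Rightarrow> ennreal"
  assumes [measurable]: "f \<in> borel_measurable borel"
  shows "(\<integral>\<^sup>+x. f x \<partial>gaussian \<sigma>) = (\<integral>\<^sup>+x. normal_density 0 \<sigma> x * f x \<partial>lborel)"
  unfolding gaussian_def by (subst nn_integral_density) auto

lemma nn_integral_normal_density: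
  assumes "\<sigma> > 0"
  shows "(\<integral>\<^sup>+x. ennreal (normal_density \<mu> \<sigma> x) \<partial>lborel) = 1"
  using prob_space.emeasure_space_1[OF prob_space_normal_density[OF assms, of \<mu>]]
  by (simp add: emeasure_density)

text \<open>Completing the square: tilting the centred density by \<open>exp (\<theta> * x)\<close>
  moves its mean to \<open>\<theta> * \<sigma>\<^sup>2\<close> and leaves a constant factor, the
  moment generating function. It feeds the Chernoff bound for inner products.\<close>

lemma gaussian_exp_linear:
  assumes "\<sigma> > 0"
  shows "(\<integral>\<^sup>+x. ennreal (exp (\<theta> * x)) \<partial>gaussian \<sigma>) = ennreal (exp (\<theta>\<^sup>2 * \<sigma>\<^sup>2 / 2))"
proof -
  have "normal_density 0 \<sigma> x * exp (\<theta> * x) =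
      exp (\<theta>\<^sup>2 * \<sigma>\<^sup>2 / 2) * normal_density (\<theta> * \<sigma>\<^sup>2) \<sigma> x" for x
  proof -
    have "- (x - 0)\<^sup>2 / (2 * \<sigma>\<^sup>2) + \<theta> * x =
        \<theta>\<^sup>2 * \<sigma>\<^sup>2 / 2 + - (x - \<theta> * \<sigma>\<^sup>2)\<^sup>2 / (2 * \<sigma>\<^sup>2)"
      using assms by (simp add: field_simps power2_eq_square)
    then have "exp (- (x - 0)\<^sup>2 / (2 * \<sigma>\<^sup>2)) * exp (\<theta> * x) =
        exp (\<theta>\<^sup>2 * \<sigma>\<^sup>2 / 2) * exp (- (x - \<theta> * \<sigma>\<^sup>2)\<^sup>2 / (2 * \<sigma>\<^sup>2))"
      by (simp only: exp_add[symmetric])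
    then show ?thesis by (simp add: normal_density_def)
  qed
  then have "(\<integral>\<^sup>+x. ennreal (exp (\<theta> * x)) \<partial>gaussian \<sigma>) =
      (\<integral>\<^sup>+x. ennreal (exp (\<theta>\<^sup>2 * \<sigma>\<^sup>2 / 2)) * normal_density (\<theta> * \<sigma>\<^sup>2) \<sigma> x \<partial>lborel)"
    by (subst nn_integral_gaussian) (auto simp flip: ennreal_mult intro!: nn_integral_cong)
  also have "\<dots> = ennreal (exp (\<theta>\<^sup>2 * \<sigma>\<^sup>2 / 2))"
    using assms by (subst nn_integral_cmult) (auto simp: nn_integral_normal_density)
  finally show ?thesis .
qed

text \<open>A quadratic tilt keeps the mean 0 and only shrinks the standard deviation to
  \<open>\<rho>\<close>; the value is the ratio of the two normalising constants. This is the
  Laplace transform of a chi-square variable with one degree of freedom, used for the norm of the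
  response.\<close>

lemma gaussian_exp_square:
  assumes "\<sigma> > 0" "\<kappa> \<ge> 0"
  shows "(\<integral>\<^sup>+x. ennreal (exp (- \<kappa> * x\<^sup>2 / \<sigma>\<^sup>2)) \<partial>gaussian \<sigma>) = ennreal (1 / sqrt (1 + 2 * \<kappa>))"
proof -
  define \<rho> where "\<rho> = \<sigma> / sqrt (1 + 2 * \<kappa>)"
  have \<rho>: "\<rho> > 0" "\<rho>\<^sup>2 = \<sigma>\<^sup>2 / (1 + 2 * \<kappa>)"
    using assms by (auto simp: \<rho>_def power_divide)
  have "normal_density 0 \<sigma> x * exp (- \<kappa> * x\<^sup>2 / \<sigma>\<^sup>2) =
      1 / sqrt (1 + 2 * \<kappa>) * normal_density 0 \<rho> x" for x
  proof -
    have "- (x - 0)\<^sup>2 / (2 * \<sigma>\<^sup>2) + - \<kappa> * x\<^sup>2 / \<sigma>\<^sup>2 = - (x - 0)\<^sup>2 / (2 * \<rho>\<^sup>2)"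
      unfolding \<rho>(2) using assms by (simp add: field_simps)
    then have "exp (- (x - 0)\<^sup>2 / (2 * \<sigma>\<^sup>2)) * exp (- \<kappa> * x\<^sup>2 / \<sigma>\<^sup>2) =
        exp (- (x - 0)\<^sup>2 / (2 * \<rho>\<^sup>2))"
      by (simp only: exp_add[symmetric])
    moreover have "1 / sqrt (2 * pi * \<sigma>\<^sup>2) = 1 / sqrt (1 + 2 * \<kappa>) * (1 / sqrt (2 * pi * \<rho>\<^sup>2))"
      using assms by (simp add: \<rho> real_sqrt_mult real_sqrt_divide)
    ultimately show ?thesis by (simp add: normal_density_def)
  qed
  then have "(\<integral>\<^sup>+x. ennreal (exp (- \<kappa> * x\<^sup>2 / \<sigma>\<^sup>2)) \<partial>gaussian \<sigma>) =
      (\<integral>\<^sup>+x. ennreal (1 / sqrt (1 + 2 * \<kappa>)) * normal_density 0 \<rho> x \<partial>lborel)"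
    using assms by (subst nn_integral_gaussian) (auto simp flip: ennreal_mult intro!: nn_integral_cong)
  also have "\<dots> = ennreal (1 / sqrt (1 + 2 * \<kappa>))"
    using \<rho> by (subst nn_integral_cmult) (auto simp: nn_integral_normal_density)
  finally show ?thesis .
qed

section \<open>Regression of one Gaussian variable on another\<close>

text \<open>Bayes factorisation of the joint density of \<open>x\<close> and
  \<open>y = \<beta> * x + u\<close>: on the left the law of \<open>x\<close> times that of
  \<open>y\<close> given \<open>x\<close>, on the right the law of \<open>y\<close> times that of
  \<open>x\<close> given \<open>y\<close>. The conditional variance is
  \<open>1 - \<beta>\<^sup>2 / s\<^sup>2 = \<tau>\<^sup>2 / s\<^sup>2\<close>.\<close>

lemma normal_density_shear:
  fixes \<beta> \<tau> :: real
  assumes "\<tau> > 0"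
  defines "s \<equiv> sqrt (\<tau>\<^sup>2 + \<beta>\<^sup>2)"
  shows "normal_density 0 1 x * normal_density 0 \<tau> (y - \<beta> * x) =
    normal_density 0 (\<tau> / s) (x - \<beta> / s\<^sup>2 * y) * normal_density 0 s y"
proof -
  have s: "s\<^sup>2 = \<tau>\<^sup>2 + \<beta>\<^sup>2" "s > 0"
    using assms by (auto simp: s_def intro: add_pos_nonneg)
  have "- (x - 0)\<^sup>2 / (2 * 1\<^sup>2) + - (y - \<beta> * x - 0)\<^sup>2 / (2 * \<tau>\<^sup>2) =
     - (x - \<beta> / s\<^sup>2 * y - 0)\<^sup>2 / (2 * (\<tau> / s)\<^sup>2) + - (y - 0)\<^sup>2 / (2 * s\<^sup>2)"
  proof -
    have "(x - \<beta> / s\<^sup>2 * y)\<^sup>2 / (2 * (\<tau> / s)\<^sup>2) = (s\<^sup>2 * x - \<beta> * y)\<^sup>2 / (2 * \<tau>\<^sup>2 * s\<^sup>2)"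
    proof -
      have "x - \<beta> / s\<^sup>2 * y = (s\<^sup>2 * x - \<beta> * y) / s\<^sup>2"
        using s(2) by (simp add: diff_divide_distrib)
      then show ?thesis
        using s(2) assms(1) by (simp add: power_divide power2_eq_square)
    qed
    moreover have "x\<^sup>2 / 2 + (y - \<beta> * x)\<^sup>2 / (2 * \<tau>\<^sup>2) =
        (s\<^sup>2 * x - \<beta> * y)\<^sup>2 / (2 * \<tau>\<^sup>2 * s\<^sup>2) + y\<^sup>2 / (2 * s\<^sup>2)"
    proof -
      have "(s\<^sup>2 * x - \<beta> * y)\<^sup>2 / (2 * \<tau>\<^sup>2 * s\<^sup>2) + y\<^sup>2 / (2 * s\<^sup>2) =
          ((s\<^sup>2 * x - \<beta> * y)\<^sup>2 + \<tau>\<^sup>2 * y\<^sup>2) / (2 * \<tau>\<^sup>2 * s\<^sup>2)"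
        using s assms by (simp add: add_divide_distrib)
      \<comment> \<open>The relation \<open>s\<^sup>2 = \<tau>\<^sup>2 + \<beta>\<^sup>2\<close>
        enters here: it merges the two multiples of \<open>y\<^sup>2\<close> into
        \<open>s\<^sup>2 * y\<^sup>2\<close>, so that \<open>s\<^sup>2\<close> factors out.\<close>
      also have "(s\<^sup>2 * x - \<beta> * y)\<^sup>2 + \<tau>\<^sup>2 * y\<^sup>2 = s\<^sup>2 * (\<tau>\<^sup>2 * x\<^sup>2 + (y - \<beta> * x)\<^sup>2)"
        unfolding s by (simp add: power2_eq_square algebra_simps)
      also have "\<dots> / (2 * \<tau>\<^sup>2 * s\<^sup>2) = (\<tau>\<^sup>2 * x\<^sup>2 + (y - \<beta> * x)\<^sup>2) / (2 * \<tau>\<^sup>2)"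
        using s by simp
      also have "\<dots> = x\<^sup>2 / 2 + (y - \<beta> * x)\<^sup>2 / (2 * \<tau>\<^sup>2)"
        using assms by (simp add: add_divide_distrib)
      finally show ?thesis by simp
    qed
    ultimately show ?thesis by simp
  qed
  then have "exp (- (x - 0)\<^sup>2 / (2 * 1\<^sup>2)) * exp (- (y - \<beta> * x - 0)\<^sup>2 / (2 * \<tau>\<^sup>2)) =
     exp (- (x - \<beta> / s\<^sup>2 * y - 0)\<^sup>2 / (2 * (\<tau> / s)\<^sup>2)) * exp (- (y - 0)\<^sup>2 / (2 * s\<^sup>2))"
    by (simp only: exp_add[symmetric])
  moreover have "1 / sqrt (2 * pi * 1\<^sup>2) * (1 / sqrt (2 * pi * \<tau>\<^sup>2)) =
      1 / sqrt (2 * pi * (\<tau> / s)\<^sup>2) * (1 / sqrt (2 * pi * s\<^sup>2))"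
    using s assms(1) by (simp add: real_sqrt_mult real_sqrt_divide power_divide)
  moreover have "normal_density 0 v x' * normal_density 0 v' y' =
      (1 / sqrt (2 * pi * v\<^sup>2) * (1 / sqrt (2 * pi * v'\<^sup>2))) *
      (exp (- (x' - 0)\<^sup>2 / (2 * v\<^sup>2)) * exp (- (y' - 0)\<^sup>2 / (2 * v'\<^sup>2)))" for v v' x' y'
    unfolding normal_density_def by (simp only: mult_ac)
  ultimately show ?thesis by (simp only:)
qed

lemma nn_integral_lborel_shift:
  fixes f :: "real \<Rightarrow> ennreal"
  assumes "f \<in> borel_measurable borel"
  shows "(\<integral>\<^sup>+x. f (t + x) \<partial>lborel) = (\<integral>\<^sup>+x. f x \<partial>lborel)"
  using nn_integral_real_affine[OF assms, of 1 t] by simp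

lemma emeasure_distr_eq_nn_integral:
  assumes "f \<in> M \<rightarrow>\<^sub>M N" "A \<in> sets N"
  shows "emeasure (distr M N f) A = (\<integral>\<^sup>+x. indicator A (f x) \<partial>M)"
  using assms by (subst nn_integral_distr[OF assms(1), symmetric]) auto

text \<open>Gaussian regression: the residual \<open>x - (\<beta> / s\<^sup>2) y\<close> is independent of \<open>y = \<beta> x + u\<close>.\<close>

lemma gaussian_regression:
  fixes \<beta> \<tau> :: real
  assumes "\<tau> > 0"
  defines "s \<equiv> sqrt (\<tau>\<^sup>2 + \<beta>\<^sup>2)"
  shows "distr (gaussian 1 \<Otimes>\<^sub>M gaussian \<tau>) (borel \<Otimes>\<^sub>M borel) (\<lambda>(x, u). (x, \<beta> * x + u)) =
    distr (gaussian (\<tau> / s) \<Otimes>\<^sub>M gaussian s) (borel \<Otimes>\<^sub>M borel) (\<lambda>(z, y). (z + \<beta> / s\<^sup>2 * y, y))"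
    (is "?L = ?R")
proof (rule measure_eqI)
  have s: "s > 0"
    using assms by (auto simp: s_def intro: add_pos_nonneg)
  interpret \<tau>: prob_space "gaussian \<tau>" using assms by (intro prob_space_gaussian)
  interpret s: prob_space "gaussian s" using s by (intro prob_space_gaussian)
  interpret \<nu>: prob_space "gaussian (\<tau> / s)" using s assms by (intro prob_space_gaussian) auto
  interpret p: pair_sigma_finite "gaussian (\<tau> / s)" "gaussian s" ..
  fix A assume "A \<in> sets ?L"
  then have [measurable]: "A \<in> sets (borel \<Otimes>\<^sub>M borel)" by simp
  let ?f = "indicator A :: real \<times> real \<Rightarrow> ennreal"
  have "emeasure ?L A = (\<integral>\<^sup>+z. ?f (case z of (x, u) \<Rightarrow> (x, \<beta> * x + u)) \<partial>(gaussian 1 \<Otimes>\<^sub>M gaussian \<tau>))"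
    by (subst emeasure_distr_eq_nn_integral) auto
  also have "\<dots> = (\<integral>\<^sup>+x. \<integral>\<^sup>+u. ?f (x, \<beta> * x + u) \<partial>gaussian \<tau> \<partial>gaussian 1)"
    by (subst \<tau>.nn_integral_fst[symmetric]) auto
  also have "\<dots> = (\<integral>\<^sup>+x. normal_density 0 1 x * (\<integral>\<^sup>+u. normal_density 0 \<tau> u * ?f (x, \<beta> * x + u) \<partial>lborel) \<partial>lborel)"
    by (simp add: nn_integral_gaussian)
  also have "\<dots> = (\<integral>\<^sup>+x. normal_density 0 1 x * (\<integral>\<^sup>+y. normal_density 0 \<tau> (y - \<beta> * x) * ?f (x, y) \<partial>lborel) \<partial>lborel)"
  proof (rule nn_integral_cong, rule arg_cong2[where f = "(*)"], rule refl)
    fix x :: real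
    show "(\<integral>\<^sup>+u. normal_density 0 \<tau> u * ?f (x, \<beta> * x + u) \<partial>lborel) =
      (\<integral>\<^sup>+y. normal_density 0 \<tau> (y - \<beta> * x) * ?f (x, y) \<partial>lborel)"
      using nn_integral_lborel_shift[of "\<lambda>y. normal_density 0 \<tau> (y - \<beta> * x) * ?f (x, y)" "\<beta> * x"]
      by simp
  qed
  also have "\<dots> = (\<integral>\<^sup>+x. \<integral>\<^sup>+y. ennreal (normal_density 0 1 x * normal_density 0 \<tau> (y - \<beta> * x)) * ?f (x, y) \<partial>lborel \<partial>lborel)"
    by (simp add: ennreal_mult mult.assoc nn_integral_cmult)
  also have "\<dots> = (\<integral>\<^sup>+x. \<integral>\<^sup>+y. ennreal (normal_density 0 (\<tau> / s) (x - \<beta> / s\<^sup>2 * y) * normal_density 0 s y) * ?f (x, y) \<partial>lborel \<partial>lborel)"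
    by (simp only: normal_density_shear[OF assms(1), of _ _ \<beta>, folded s_def])
  \<comment> \<open>The new factorisation conditions on \<open>y\<close>, so \<open>y\<close> has to
    become the outer variable before \<open>x\<close> can be translated to the residual
    \<open>z\<close>.\<close>
  also have "\<dots> = (\<integral>\<^sup>+y. \<integral>\<^sup>+x. ennreal (normal_density 0 (\<tau> / s) (x - \<beta> / s\<^sup>2 * y) * normal_density 0 s y) * ?f (x, y) \<partial>lborel \<partial>lborel)"
    by (rule lborel_pair.Fubini') measurable
  also have "\<dots> = (\<integral>\<^sup>+y. normal_density 0 s y * (\<integral>\<^sup>+x. normal_density 0 (\<tau> / s) (x - \<beta> / s\<^sup>2 * y) * ?f (x, y) \<partial>lborel) \<partial>lborel)"
    by (simp add: ennreal_mult mult.assoc mult.left_commute[of "ennreal (normal_density 0 (\<tau> / s) _)"] nn_integral_cmult)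
  also have "\<dots> = (\<integral>\<^sup>+y. normal_density 0 s y * (\<integral>\<^sup>+z. normal_density 0 (\<tau> / s) z * ?f (z + \<beta> / s\<^sup>2 * y, y) \<partial>lborel) \<partial>lborel)"
  proof (rule nn_integral_cong, rule arg_cong2[where f = "(*)"], rule refl)
    fix y :: real
    show "(\<integral>\<^sup>+x. normal_density 0 (\<tau> / s) (x - \<beta> / s\<^sup>2 * y) * ?f (x, y) \<partial>lborel) =
      (\<integral>\<^sup>+z. normal_density 0 (\<tau> / s) z * ?f (z + \<beta> / s\<^sup>2 * y, y) \<partial>lborel)"
      using nn_integral_lborel_shift[of "\<lambda>x. normal_density 0 (\<tau> / s) (x - \<beta> / s\<^sup>2 * y) * ?f (x, y)" "\<beta> / s\<^sup>2 * y"]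
      by (simp add: add.commute)
  qed
  also have "\<dots> = (\<integral>\<^sup>+y. \<integral>\<^sup>+z. ?f (z + \<beta> / s\<^sup>2 * y, y) \<partial>gaussian (\<tau> / s) \<partial>gaussian s)"
    by (simp add: nn_integral_gaussian)
  also have "\<dots> = (\<integral>\<^sup>+z. ?f (case z of (z, y) \<Rightarrow> (z + \<beta> / s\<^sup>2 * y, y)) \<partial>(gaussian (\<tau> / s) \<Otimes>\<^sub>M gaussian s))"
    by (subst p.nn_integral_snd[symmetric]) auto
  also have "\<dots> = emeasure ?R A"
    by (subst emeasure_distr_eq_nn_integral) auto
  finally show "emeasure ?L A = emeasure ?R A" .
qed simp

subsection \<open>Rearranging product measures\<close>

lemma measurable_PiM_uncurry:
  "(\<lambda>f. \<lambda>(i, j)\<in>I \<times> J. f i j) \<in> PiM I (\<lambda>i. PiM J (\<lambda>j. M (i, j))) \<rightarrow>\<^sub>M PiM (I \<times> J) M"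
proof (rule measurable_restrict, clarify)
  fix i j assume "i \<in> I" "j \<in> J"
  then show "(\<lambda>f. f i j) \<in> PiM I (\<lambda>i. PiM J (\<lambda>j. M (i, j))) \<rightarrow>\<^sub>M M (i, j)"
    by (intro measurable_compose[of "\<lambda>f. f i" _ "PiM J (\<lambda>j. M (i, j))" "\<lambda>g. g j"]
        measurable_component_singleton)
qed

text \<open>A finite product measure is determined by its values on boxes, and the preimage of a box
  under uncurrying is a box of boxes. With \<open>distr_PiM_curry\<close> this lets the matrix be
  treated as a family of independent rows.\<close>

lemma distr_PiM_uncurry:
  assumes "finite I" "finite J" "\<And>i. prob_space (M i)"
  shows "distr (PiM I (\<lambda>i. PiM J (\<lambda>j. M (i, j)))) (PiM (I \<times> J) M) (\<lambda>f. \<lambda>(i, j)\<in>I \<times> J. f i j) = PiM (I \<times> J) M"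
proof -
  interpret product_prob_space M "I \<times> J" using assms(3) by (intro product_prob_spaceI)
  have prob: "prob_space (PiM J (\<lambda>j. M (i, j)))" for i
    using assms(3) by (intro prob_space_PiM)
  interpret R: product_prob_space "\<lambda>i. PiM J (\<lambda>j. M (i, j))" I using prob by (intro product_prob_spaceI)
  have meas [measurable]: "(\<lambda>f. \<lambda>(i, j)\<in>I \<times> J. f i j) \<in> PiM I (\<lambda>i. PiM J (\<lambda>j. M (i, j))) \<rightarrow>\<^sub>M PiM (I \<times> J) M"
    by (rule measurable_PiM_uncurry)
  show ?thesis
  proof (rule PiM_eqI)
    fix A assume A: "\<And>i. i \<in> I \<times> J \<Longrightarrow> A i \<in> sets (M i)"
    have sub: "A (i, j) \<subseteq> space (M (i, j))" if "i \<in> I" "j \<in> J" for i j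
      using sets.sets_into_space[OF A] that by simp
    have "(\<lambda>f. \<lambda>(i, j)\<in>I \<times> J. f i j) -` Pi\<^sub>E (I \<times> J) A \<inter> space (PiM I (\<lambda>i. PiM J (\<lambda>j. M (i, j)))) =
        (\<Pi>\<^sub>E i\<in>I. \<Pi>\<^sub>E j\<in>J. A (i, j))" (is "?V = _")
    proof (intro set_eqI)
      fix f
      have "f \<in> ?V \<longleftrightarrow> f \<in> extensional I \<and> (\<forall>i\<in>I. f i \<in> extensional J \<and>
          (\<forall>j\<in>J. f i j \<in> space (M (i, j)) \<and> f i j \<in> A (i, j)))"
        by (auto simp: space_PiM PiE_iff)
      also have "\<dots> \<longleftrightarrow> f \<in> (\<Pi>\<^sub>E i\<in>I. \<Pi>\<^sub>E j\<in>J. A (i, j))"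
        by (auto simp: PiE_iff intro!: subsetD[OF sub])
      finally show "f \<in> ?V \<longleftrightarrow> f \<in> (\<Pi>\<^sub>E i\<in>I. \<Pi>\<^sub>E j\<in>J. A (i, j))" .
    qed
    then have "emeasure (distr (PiM I (\<lambda>i. PiM J (\<lambda>j. M (i, j)))) (PiM (I \<times> J) M) (\<lambda>f. \<lambda>(i, j)\<in>I \<times> J. f i j)) (Pi\<^sub>E (I \<times> J) A)
       = emeasure (PiM I (\<lambda>i. PiM J (\<lambda>j. M (i, j)))) (\<Pi>\<^sub>E i\<in>I. \<Pi>\<^sub>E j\<in>J. A (i, j))"
      using A assms by (subst emeasure_distr) (auto intro!: sets_PiM_I_finite)
    also have "\<dots> = (\<Prod>i\<in>I. emeasure (PiM J (\<lambda>j. M (i, j))) (\<Pi>\<^sub>E j\<in>J. A (i, j)))"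
      using A assms by (intro R.emeasure_PiM) (auto intro!: sets_PiM_I_finite)
    also have "\<dots> = (\<Prod>i\<in>I. \<Prod>j\<in>J. emeasure (M (i, j)) (A (i, j)))"
    proof (intro prod.cong refl)
      fix i assume "i \<in> I"
      interpret J: product_prob_space "\<lambda>j. M (i, j)" J using assms(3) by (intro product_prob_spaceI)
      show "emeasure (PiM J (\<lambda>j. M (i, j))) (\<Pi>\<^sub>E j\<in>J. A (i, j)) = (\<Prod>j\<in>J. emeasure (M (i, j)) (A (i, j)))"
        using A assms \<open>i \<in> I\<close> by (intro J.emeasure_PiM) auto
    qed
    also have "\<dots> = (\<Prod>i\<in>I \<times> J. emeasure (M i) (A i))"
      by (simp add: prod.cartesian_product split_beta)
    finally show "emeasure (distr (PiM I (\<lambda>i. PiM J (\<lambda>j. M (i, j)))) (PiM (I \<times> J) M) (\<lambda>f. \<lambda>(i, j)\<in>I \<times> J. f i j)) (Pi\<^sub>E (I \<times> J) A) =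
       (\<Prod>i\<in>I \<times> J. emeasure (M i) (A i))" .
  qed (use assms in auto)
qed

text \<open>Follows from the uncurried version because currying undoes uncurrying on extensional
  functions.\<close>

lemma distr_PiM_curry:
  assumes "finite I" "finite J" "\<And>i. prob_space (M i)"
  shows "distr (PiM (I \<times> J) M) (PiM I (\<lambda>i. PiM J (\<lambda>j. M (i, j)))) (\<lambda>f. \<lambda>i\<in>I. \<lambda>j\<in>J. f (i, j)) =
    PiM I (\<lambda>i. PiM J (\<lambda>j. M (i, j)))"
proof -
  let ?P = "PiM I (\<lambda>i. PiM J (\<lambda>j. M (i, j)))"
  have meas [measurable]: "(\<lambda>f. \<lambda>(i, j)\<in>I \<times> J. f i j) \<in> ?P \<rightarrow>\<^sub>M PiM (I \<times> J) M"
    by (rule measurable_PiM_uncurry)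
  have [measurable]: "(\<lambda>f. \<lambda>i\<in>I. \<lambda>j\<in>J. f (i, j)) \<in> PiM (I \<times> J) M \<rightarrow>\<^sub>M ?P"
    by (intro measurable_restrict) auto
  have "distr (PiM (I \<times> J) M) ?P (\<lambda>f. \<lambda>i\<in>I. \<lambda>j\<in>J. f (i, j)) =
      distr (distr ?P (PiM (I \<times> J) M) (\<lambda>f. \<lambda>(i, j)\<in>I \<times> J. f i j)) ?P (\<lambda>f. \<lambda>i\<in>I. \<lambda>j\<in>J. f (i, j))"
    by (simp add: distr_PiM_uncurry assms)
  also have "\<dots> = distr ?P ?P ((\<lambda>f. \<lambda>i\<in>I. \<lambda>j\<in>J. f (i, j)) \<circ> (\<lambda>f. \<lambda>(i, j)\<in>I \<times> J. f i j))"
    by (rule distr_distr) measurable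
  also have "\<dots> = distr ?P ?P (\<lambda>x. x)"
    by (rule distr_cong)
       (auto simp: space_PiM PiE_iff extensional_def fun_eq_iff)
  finally show ?thesis by (simp add: distr_id)
qed

text \<open>Two independent vectors become one vector of independent pairs. The factors
  \<open>A i\<close> of a box are arbitrary measurable sets of pairs and not only rectangles, so its
  mass is found by integrating a product of indicators one coordinate at a time.\<close>

lemma distr_PiM_zip:
  assumes I: "finite I" and M: "\<And>i. prob_space (M i)" and N: "\<And>i. prob_space (N i)"
  shows "distr (PiM I M \<Otimes>\<^sub>M PiM I N) (PiM I (\<lambda>i. M i \<Otimes>\<^sub>M N i)) (\<lambda>(f, g). \<lambda>i\<in>I. (f i, g i)) =
    PiM I (\<lambda>i. M i \<Otimes>\<^sub>M N i)"
proof -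
  interpret M: product_prob_space M I using M by (intro product_prob_spaceI)
  interpret N: product_prob_space N I using N by (intro product_prob_spaceI)
  have MN: "prob_space (M i \<Otimes>\<^sub>M N i)" for i
  proof -
    interpret prob_space "M i" by (rule M)
    interpret N: prob_space "N i" by (rule N)
    interpret pair_prob_space "M i" "N i" ..
    show ?thesis by unfold_locales
  qed
  interpret MN: product_prob_space "\<lambda>i. M i \<Otimes>\<^sub>M N i" I using MN by (intro product_prob_spaceI)
  interpret P: pair_prob_space "PiM I M" "PiM I N" ..
  have meas [measurable]: "(\<lambda>(f, g). \<lambda>i\<in>I. (f i, g i)) \<in> PiM I M \<Otimes>\<^sub>M PiM I N \<rightarrow>\<^sub>M PiM I (\<lambda>i. M i \<Otimes>\<^sub>M N i)"
    by (auto simp: split_beta intro!: measurable_restrict)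
  show ?thesis
  proof (rule MN.PiM_eqI)
    fix A assume A: "\<And>i. i \<in> I \<Longrightarrow> A i \<in> sets (M i \<Otimes>\<^sub>M N i)"
    have AP [measurable]: "Pi\<^sub>E I A \<in> sets (PiM I (\<lambda>i. M i \<Otimes>\<^sub>M N i))"
      using A I by (intro sets_PiM_I_finite)
    have "emeasure (distr (PiM I M \<Otimes>\<^sub>M PiM I N) (PiM I (\<lambda>i. M i \<Otimes>\<^sub>M N i)) (\<lambda>(f, g). \<lambda>i\<in>I. (f i, g i))) (Pi\<^sub>E I A)
      = (\<integral>\<^sup>+x. indicator (Pi\<^sub>E I A) (case x of (f, g) \<Rightarrow> \<lambda>i\<in>I. (f i, g i)) \<partial>(PiM I M \<Otimes>\<^sub>M PiM I N))"
      by (subst emeasure_distr_eq_nn_integral) auto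
    also have "\<dots> = (\<integral>\<^sup>+f. \<integral>\<^sup>+g. indicator (Pi\<^sub>E I A) (\<lambda>i\<in>I. (f i, g i)) \<partial>PiM I N \<partial>PiM I M)"
      by (subst N.P.nn_integral_fst[symmetric]) (auto simp: split_beta)
    also have "\<dots> = (\<integral>\<^sup>+f. \<integral>\<^sup>+g. (\<Prod>i\<in>I. indicator (A i) (f i, g i)) \<partial>PiM I N \<partial>PiM I M)"
    proof (intro nn_integral_cong)
      fix f g
      show "indicator (Pi\<^sub>E I A) (\<lambda>i\<in>I. (f i, g i)) = (\<Prod>i\<in>I. indicator (A i) (f i, g i) :: ennreal)"
      proof (cases "\<forall>i\<in>I. (f i, g i) \<in> A i")
        case True then show ?thesis by (auto simp: indicator_def)
      next
        case False then show ?thesis using I by (auto simp: indicator_def PiE_iff intro: prod_zero[symmetric])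
      qed
    qed
    also have "\<dots> = (\<integral>\<^sup>+f. (\<Prod>i\<in>I. \<integral>\<^sup>+y. indicator (A i) (f i, y) \<partial>N i) \<partial>PiM I M)"
    proof (intro nn_integral_cong)
      fix f assume f: "f \<in> space (PiM I M)"
      show "(\<integral>\<^sup>+g. (\<Prod>i\<in>I. indicator (A i) (f i, g i)) \<partial>PiM I N) = (\<Prod>i\<in>I. \<integral>\<^sup>+y. indicator (A i) (f i, y) \<partial>N i)"
      proof (rule N.product_nn_integral_prod[OF I])
        fix i assume "i \<in> I"
        then have "f i \<in> space (M i)" using f by (auto simp: space_PiM)
        then show "(\<lambda>y. indicator (A i) (f i, y)) \<in> borel_measurable (N i)"
          using A[OF \<open>i \<in> I\<close>] by measurable
      qed
    qed
    also have "\<dots> = (\<Prod>i\<in>I. \<integral>\<^sup>+x. \<integral>\<^sup>+y. indicator (A i) (x, y) \<partial>N i \<partial>M i)"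
    proof (rule M.product_nn_integral_prod[OF I])
      fix i assume "i \<in> I"
      then have [measurable]: "A i \<in> sets (M i \<Otimes>\<^sub>M N i)" by (rule A)
      interpret prob_space "N i" by (rule N)
      show "(\<lambda>x. \<integral>\<^sup>+y. indicator (A i) (x, y) \<partial>N i) \<in> borel_measurable (M i)" by measurable
    qed
    also have "\<dots> = (\<Prod>i\<in>I. emeasure (M i \<Otimes>\<^sub>M N i) (A i))"
    proof (intro prod.cong refl)
      fix i assume "i \<in> I"
      interpret prob_space "N i" by (rule N)
      show "(\<integral>\<^sup>+x. \<integral>\<^sup>+y. indicator (A i) (x, y) \<partial>N i \<partial>M i) = emeasure (M i \<Otimes>\<^sub>M N i) (A i)"
        using A[OF \<open>i \<in> I\<close>] by (simp add: N.M.emeasure_pair_measure)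
    qed
    finally show "emeasure (distr (PiM I M \<Otimes>\<^sub>M PiM I N) (PiM I (\<lambda>i. M i \<Otimes>\<^sub>M N i)) (\<lambda>(f, g). \<lambda>i\<in>I. (f i, g i))) (Pi\<^sub>E I A) =
        (\<Prod>i\<in>I. emeasure (M i \<Otimes>\<^sub>M N i) (A i))" .
  qed (use I in auto)
qed

subsection \<open>Regression of a column on the response\<close>

lemma indep_vars_PiM_coordinates:
  assumes "\<And>i. i \<in> I \<Longrightarrow> prob_space (M i)" "I \<noteq> {}"
  shows "prob_space.indep_vars (PiM I M) M (\<lambda>i \<omega>. \<omega> i) I"
proof -
  interpret prob_space "PiM I M" by (rule prob_space_PiM) (rule assms)
  have "distr (PiM I M) (PiM I M) (\<lambda>x. \<lambda>i\<in>I. x i) = distr (PiM I M) (PiM I M) (\<lambda>x. x)"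
    by (rule distr_cong) (auto simp: space_PiM)
  then have "distr (PiM I M) (PiM I M) (\<lambda>x. \<lambda>i\<in>I. x i) = PiM I (\<lambda>i. distr (PiM I M) (M i) (\<lambda>x. x i))"
    using assms by (simp add: distr_id distr_PiM_component cong: PiM_cong)
  then show ?thesis
    using assms(2) by (subst indep_vars_iff_distr_eq_PiM') auto
qed

text \<open>The usual insertion of a coordinate with the two factors swapped; this order matches a
  row followed by its noise entry.\<close>

lemma distr_pair_PiM_upd:
  assumes "\<And>i. i \<in> I \<Longrightarrow> prob_space (M i)" "prob_space (M k)"
  shows "distr (PiM I M \<Otimes>\<^sub>M M k) (PiM (insert k I) M) (\<lambda>(X, x). X(k := x)) = PiM (insert k I) M"
proof -
  interpret I: prob_space "PiM I M" by (rule prob_space_PiM) (rule assms)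
  interpret k: prob_space "M k" by (rule assms)
  interpret pair_prob_space "PiM I M" "M k" ..
  have "distr (PiM I M \<Otimes>\<^sub>M M k) (PiM (insert k I) M) (\<lambda>(X, x). X(k := x)) =
     distr (distr (M k \<Otimes>\<^sub>M PiM I M) (PiM I M \<Otimes>\<^sub>M M k) (\<lambda>(x, y). (y, x)))
       (PiM (insert k I) M) (\<lambda>(X, x). X(k := x))"
    by (simp flip: distr_pair_swap)
  also have "\<dots> = distr (M k \<Otimes>\<^sub>M PiM I M) (PiM (insert k I) M) (\<lambda>(x, X). X(k := x))"
    by (subst distr_distr) (auto simp: comp_def case_prod_beta')
  also have "\<dots> = PiM (insert k I) M"
    using assms by (rule distr_pair_PiM_eq_PiM)
  finally show ?thesis .
qed

lemma distributed_gaussian_scale: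
  assumes M: "prob_space M" and X: "X \<in> M \<rightarrow>\<^sub>M borel" "distr M borel X = gaussian \<sigma>"
    and "\<sigma> > 0" "c \<noteq> 0"
  shows "distributed M lborel (\<lambda>\<omega>. c * X \<omega>) (normal_density 0 (\<bar>c\<bar> * \<sigma>))"
proof -
  interpret prob_space M by (rule M)
  have "distr M lborel X = distr M borel X"
    by (rule distr_cong) auto
  then have "distributed M lborel X (normal_density 0 \<sigma>)"
    using X by (auto simp: distributed_def gaussian_def)
  from normal_density_affine[OF this \<open>\<sigma> > 0\<close> \<open>c \<noteq> 0\<close>, of 0] show ?thesis by simp
qed

text \<open>Treats the noise entry as one more coordinate, with index \<open>p\<close> and
  coefficient 1. What is left of the response after removing column \<open>j\<close> is then a
  weighted sum of independent normals that does not involve coordinate \<open>j\<close>, hence is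
  independent of it, and the variances add up to \<open>\<tau>\<^sup>2\<close>.\<close>

lemma row_pair_distr:
  fixes b :: "nat \<Rightarrow> real" and \<sigma> :: real
  assumes "\<sigma> > 0" "j < p"
  defines "\<tau> \<equiv> sqrt (\<sigma>\<^sup>2 + (\<Sum>l\<in>{..<p} - {j}. (b l)\<^sup>2))"
  shows "distr (PiM {..<p} (\<lambda>_. gaussian 1) \<Otimes>\<^sub>M gaussian \<sigma>) (borel \<Otimes>\<^sub>M borel)
      (\<lambda>(x, u). (x j, (\<Sum>l\<in>{..<p} - {j}. x l * b l) + u)) = gaussian 1 \<Otimes>\<^sub>M gaussian \<tau>"
proof -
  define N where "N l = gaussian (if l = p then \<sigma> else 1)" for l
  define c where "c = b(p := 1)"
  \<comment> \<open>The rule for sums of independent normals is applied with positive standard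
    deviations, so zero coefficients are dropped. The index \<open>p\<close> stays because
    \<open>c p = 1\<close>, hence \<open>K\<close> is nonempty.\<close>
  define K where "K = {l \<in> insert p {..<p}. c l \<noteq> 0} - {j}"
  define Q where "Q = PiM (insert p {..<p}) N"
  have N: "prob_space (N l)" for l
    using assms unfolding N_def by (intro prob_space_gaussian) auto
  have sets_N [measurable_cong]: "sets (N l) = sets borel" for l by (simp add: N_def)
  have Q: "distr (PiM {..<p} (\<lambda>_. gaussian 1) \<Otimes>\<^sub>M gaussian \<sigma>) Q (\<lambda>(x, u). x(p := u)) = Q"
  proof -
    have "PiM {..<p} (\<lambda>_. gaussian 1) = PiM {..<p} N" by (intro PiM_cong) (auto simp: N_def)
    moreover have "gaussian \<sigma> = N p" by (simp add: N_def)
    ultimately show ?thesis unfolding Q_def using N by (simp only:) (rule distr_pair_PiM_upd)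
  qed
  interpret Q: prob_space Q unfolding Q_def using N by (intro prob_space_PiM)
  \<comment> \<open>Coordinate \<open>j\<close> stays unscaled: it is the regressor itself, and its
    coefficient \<open>b j\<close> is applied only in \<open>row_regression\<close>.\<close>
  define X where "X l \<omega> = (if l = j then \<omega> j else c l * \<omega> l)" for l and \<omega> :: "nat \<Rightarrow> real"
  have K: "finite K" "j \<notin> K" "p \<in> K" "insert j K \<subseteq> insert p {..<p}"
    using assms by (auto simp: K_def c_def)
  have meas [measurable]: "(\<lambda>\<omega>. \<omega> l) \<in> Q \<rightarrow>\<^sub>M borel" if "l \<in> insert p {..<p}" for l
    using measurable_component_singleton[OF that, of N] by (simp add: Q_def sets_N cong: measurable_cong_sets)
  have "Q.indep_vars N (\<lambda>i \<omega>. \<omega> i) (insert p {..<p})"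
    unfolding Q_def using N by (intro indep_vars_PiM_coordinates) auto
  then have "Q.indep_vars N (\<lambda>i \<omega>. \<omega> i) (insert j K)"
    using K(4) by (rule Q.indep_vars_subset)
  then have "Q.indep_vars (\<lambda>_. borel) (\<lambda>i \<omega>. (if i = j then \<lambda>x. x else (\<lambda>x. c i * x)) (\<omega> i)) (insert j K)"
    by (rule Q.indep_vars_compose2) (simp add: measurable_cong_sets[OF sets_N refl])
  then have ind: "Q.indep_vars (\<lambda>_. borel) X (insert j K)"
    by (rule Q.indep_vars_cong[THEN iffD1, rotated -1]) (auto simp: X_def)
  have distr_coord: "distr Q borel (\<lambda>\<omega>. \<omega> l) = N l" if "l \<in> insert p {..<p}" for l
  proof -
    have "distr Q borel (\<lambda>\<omega>. \<omega> l) = distr Q (N l) (\<lambda>\<omega>. \<omega> l)"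
      by (rule distr_cong) (auto simp: sets_N)
    also have "\<dots> = N l"
      unfolding Q_def using N that by (intro distr_PiM_component)
    finally show ?thesis .
  qed
  have "distributed Q lborel (\<lambda>\<omega>. \<Sum>l\<in>K. X l \<omega>)
      (normal_density (\<Sum>l\<in>K. 0) (sqrt (\<Sum>l\<in>K. (\<bar>c l\<bar> * (if l = p then \<sigma> else 1))\<^sup>2)))"
  proof (rule Q.sum_indep_normal)
    show "Q.indep_vars (\<lambda>i. borel) X K" using ind by (rule Q.indep_vars_subset) auto
    fix l assume l: "l \<in> K"
    then show "0 < \<bar>c l\<bar> * (if l = p then \<sigma> else 1)" using assms by (auto simp: K_def)
    have "distributed Q lborel (\<lambda>\<omega>. c l * \<omega> l) (normal_density 0 (\<bar>c l\<bar> * (if l = p then \<sigma> else 1)))"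
      using l assms K(4)
      by (intro distributed_gaussian_scale) (auto simp: K_def distr_coord N_def Q.prob_space_axioms meas)
    moreover have "X l = (\<lambda>\<omega>. c l * \<omega> l)" using l K(2) by (auto simp: X_def)
    ultimately show "distributed Q lborel (X l) (normal_density 0 (\<bar>c l\<bar> * (if l = p then \<sigma> else 1)))"
      by simp
  qed (use K in auto)
  \<comment> \<open>The dropped indices have coefficient 0 and add nothing to the variance.\<close>
  also have "(\<Sum>l\<in>K. (\<bar>c l\<bar> * (if l = p then \<sigma> else 1))\<^sup>2) =
      (\<Sum>l\<in>insert p ({..<p} - {j}). (\<bar>c l\<bar> * (if l = p then \<sigma> else 1))\<^sup>2)"
    using assms by (intro sum.mono_neutral_left) (auto simp: K_def)
  also have "\<dots> = \<sigma>\<^sup>2 + (\<Sum>l\<in>{..<p} - {j}. (\<bar>c l\<bar> * (if l = p then \<sigma> else 1))\<^sup>2)"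
    by (subst sum.insert) (auto simp: c_def)
  also have "(\<Sum>l\<in>{..<p} - {j}. (\<bar>c l\<bar> * (if l = p then \<sigma> else 1))\<^sup>2) = (\<Sum>l\<in>{..<p} - {j}. (b l)\<^sup>2)"
    by (intro sum.cong) (auto simp: c_def)
  finally have "distributed Q lborel (\<lambda>\<omega>. \<Sum>l\<in>K. X l \<omega>) (normal_density 0 \<tau>)"
    by (simp add: \<tau>_def)
  then have law_sum: "distr Q borel (\<lambda>\<omega>. \<Sum>l\<in>K. X l \<omega>) = gaussian \<tau>"
    unfolding gaussian_def distributed_def by (metis distr_cong sets_lborel)
  have law_j: "distr Q borel (X j) = gaussian 1"
    using distr_coord[of j] assms by (simp add: X_def[abs_def] N_def)
  have joint: "distr Q (borel \<Otimes>\<^sub>M borel) (\<lambda>\<omega>. (X j \<omega>, \<Sum>l\<in>K. X l \<omega>)) = gaussian 1 \<Otimes>\<^sub>M gaussian \<tau>"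
    using Q.indep_vars_sum[OF K(1,2) ind] unfolding Q.indep_var_distribution_eq law_sum law_j by simp
  have X_meas [measurable]: "X l \<in> Q \<rightarrow>\<^sub>M borel" if "l \<in> insert j K" for l
    using ind that by (auto simp: Q.indep_vars_def)
  have upd [measurable]: "(\<lambda>(x, u). x(p := u)) \<in> PiM {..<p} (\<lambda>_. gaussian 1) \<Otimes>\<^sub>M gaussian \<sigma> \<rightarrow>\<^sub>M Q"
    unfolding Q_def split_beta
    by (rule measurable_fun_upd[where J = "{..<p}"]) (auto cong: measurable_cong_sets sets_PiM_cong simp: sets_N)
  have XK: "(\<lambda>\<omega>. \<Sum>l\<in>K. X l \<omega>) \<in> Q \<rightarrow>\<^sub>M borel"
    by (rule borel_measurable_sum) (auto intro: X_meas)
  have XjK: "(\<lambda>\<omega>. (X j \<omega>, \<Sum>l\<in>K. X l \<omega>)) \<in> Q \<rightarrow>\<^sub>M borel \<Otimes>\<^sub>M borel"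
    using XK X_meas[of j] by simp
  \<comment> \<open>The joint law on \<open>Q\<close> is read on pairs of a row and its noise entry,
    through the map that stores the noise at index \<open>p\<close>.\<close>
  have "gaussian 1 \<Otimes>\<^sub>M gaussian \<tau> =
      distr (distr (PiM {..<p} (\<lambda>_. gaussian 1) \<Otimes>\<^sub>M gaussian \<sigma>) Q (\<lambda>(x, u). x(p := u)))
       (borel \<Otimes>\<^sub>M borel) (\<lambda>\<omega>. (X j \<omega>, \<Sum>l\<in>K. X l \<omega>))"
    by (simp add: Q joint)
  also have "\<dots> = distr (PiM {..<p} (\<lambda>_. gaussian 1) \<Otimes>\<^sub>M gaussian \<sigma>) (borel \<Otimes>\<^sub>M borel)
      ((\<lambda>\<omega>. (X j \<omega>, \<Sum>l\<in>K. X l \<omega>)) \<circ> (\<lambda>(x, u). x(p := u)))"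
    by (rule distr_distr[OF XjK upd])
  also have "(\<lambda>\<omega>. (X j \<omega>, \<Sum>l\<in>K. X l \<omega>)) \<circ> (\<lambda>(x, u). x(p := u)) =
      (\<lambda>(x, u). (x j, (\<Sum>l\<in>{..<p} - {j}. x l * b l) + u))"
  proof -
    have "(\<Sum>l\<in>K. X l (x(p := u))) = (\<Sum>l\<in>{..<p} - {j}. x l * b l) + u" for x u
    proof -
      have "(\<Sum>l\<in>K. X l (x(p := u))) = (\<Sum>l\<in>insert p ({..<p} - {j}). X l (x(p := u)))"
        using assms by (intro sum.mono_neutral_left) (auto simp: K_def X_def)
      also have "\<dots> = u + (\<Sum>l\<in>{..<p} - {j}. X l (x(p := u)))"
        using assms by (subst sum.insert) (auto simp: c_def X_def)
      also have "(\<Sum>l\<in>{..<p} - {j}. X l (x(p := u))) = (\<Sum>l\<in>{..<p} - {j}. x l * b l)"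
        by (intro sum.cong) (auto simp: c_def X_def)
      finally show ?thesis by (simp only: add.commute)
    qed
    then show ?thesis using assms by (auto simp: fun_eq_iff X_def)
  qed
  finally show ?thesis by simp
qed

text \<open>One entry of the response is \<open>b j * x j\<close> plus an independent Gaussian of
  variance \<open>\<tau>\<^sup>2\<close> collecting the other columns and the noise. The scalar
  regression therefore applies with slope \<open>b j\<close> and
  \<open>s\<^sup>2 = \<tau>\<^sup>2 + (b j)\<^sup>2\<close>.\<close>

lemma row_regression:
  fixes b :: "nat \<Rightarrow> real" and \<sigma> :: real
  assumes "\<sigma> > 0" "j < p"
  defines "\<tau> \<equiv> sqrt (\<sigma>\<^sup>2 + (\<Sum>l\<in>{..<p} - {j}. (b l)\<^sup>2))"
    and "s \<equiv> sqrt (\<sigma>\<^sup>2 + (\<Sum>l<p. (b l)\<^sup>2))"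
  shows "distr (PiM {..<p} (\<lambda>_. gaussian 1) \<Otimes>\<^sub>M gaussian \<sigma>) (borel \<Otimes>\<^sub>M borel)
      (\<lambda>(x, u). (x j, (\<Sum>l<p. x l * b l) + u)) =
    distr (gaussian (\<tau> / s) \<Otimes>\<^sub>M gaussian s) (borel \<Otimes>\<^sub>M borel) (\<lambda>(z, y). (z + b j / s\<^sup>2 * y, y))"
proof -
  let ?R = "PiM {..<p} (\<lambda>_. gaussian 1) \<Otimes>\<^sub>M gaussian \<sigma>"
  have split: "(\<Sum>l<p. f l) = f j + (\<Sum>l\<in>{..<p} - {j}. f l)" for f :: "nat \<Rightarrow> real"
    using assms by (intro sum.remove) auto
  have "\<tau> > 0" using assms by (auto simp: \<tau>_def intro!: add_pos_nonneg sum_nonneg)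
  have "\<tau>\<^sup>2 = \<sigma>\<^sup>2 + (\<Sum>l\<in>{..<p} - {j}. (b l)\<^sup>2)"
    by (auto simp: \<tau>_def intro!: add_nonneg_nonneg sum_nonneg)
  then have s: "s = sqrt (\<tau>\<^sup>2 + (b j)\<^sup>2)"
    by (simp add: s_def split add_ac)
  have j [measurable]: "j \<in> {..<p}" using assms by simp
  have meas: "(\<lambda>(x, u). (x j, (\<Sum>l\<in>{..<p} - {j}. x l * b l) + u)) \<in> ?R \<rightarrow>\<^sub>M borel \<Otimes>\<^sub>M borel"
    by measurable
  have "distr ?R (borel \<Otimes>\<^sub>M borel) (\<lambda>(x, u). (x j, (\<Sum>l<p. x l * b l) + u)) =
     distr ?R (borel \<Otimes>\<^sub>M borel) ((\<lambda>(x, u). (x, b j * x + u)) \<circ> (\<lambda>(x, u). (x j, (\<Sum>l\<in>{..<p} - {j}. x l * b l) + u)))"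
    by (intro arg_cong[where f = "distr _ _"]) (auto simp: split fun_eq_iff)
  also have "\<dots> = distr (distr ?R (borel \<Otimes>\<^sub>M borel) (\<lambda>(x, u). (x j, (\<Sum>l\<in>{..<p} - {j}. x l * b l) + u)))
      (borel \<Otimes>\<^sub>M borel) (\<lambda>(x, u). (x, b j * x + u))"
    by (rule distr_distr[symmetric]) (auto intro: meas)
  also have "\<dots> = distr (gaussian 1 \<Otimes>\<^sub>M gaussian \<tau>) (borel \<Otimes>\<^sub>M borel) (\<lambda>(x, u). (x, b j * x + u))"
    unfolding \<tau>_def by (subst row_pair_distr[OF assms(1,2)]) simp
  finally show ?thesis
    using gaussian_regression[OF \<open>\<tau> > 0\<close>, of "b j"] by (simp add: s)
qed

text \<open>Zipping followed by a coordinatewise map. It carries a law found for a single row over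
  to all rows at once, and is used for both sides of \<open>model_regression\<close>.\<close>

lemma distr_PiM_pair_map:
  assumes I: "finite I" and M: "prob_space M" and N: "prob_space N"
    and h [measurable]: "h \<in> M \<Otimes>\<^sub>M N \<rightarrow>\<^sub>M S"
  shows "distr (PiM I (\<lambda>_. M) \<Otimes>\<^sub>M PiM I (\<lambda>_. N)) (PiM I (\<lambda>_. S)) (\<lambda>(f, g). \<lambda>i\<in>I. h (f i, g i)) =
    PiM I (\<lambda>_. distr (M \<Otimes>\<^sub>M N) S h)"
proof -
  let ?MN = "\<lambda>_. M \<Otimes>\<^sub>M N" and ?D = "distr (M \<Otimes>\<^sub>M N) S h"
  interpret M: prob_space M by (rule M)
  interpret N: prob_space N by (rule N)
  interpret MN: pair_prob_space M N ..
  have S: "sets (PiM I (\<lambda>_. S)) = sets (PiM I (\<lambda>_. ?D))"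
    by (intro sets_PiM_cong) auto
  have h': "h \<in> M \<Otimes>\<^sub>M N \<rightarrow>\<^sub>M ?D"
    using h by (simp add: measurable_def)
  have zip [measurable]: "(\<lambda>(f, g). \<lambda>i\<in>I. (f i, g i)) \<in> PiM I (\<lambda>_. M) \<Otimes>\<^sub>M PiM I (\<lambda>_. N) \<rightarrow>\<^sub>M PiM I ?MN"
    by (auto simp: split_beta intro!: measurable_restrict)
  have comp: "compose I h \<in> PiM I ?MN \<rightarrow>\<^sub>M PiM I (\<lambda>_. S)"
    unfolding compose_def by (rule measurable_restrict) auto
  \<comment> \<open>The target is first \<open>?D\<close>, a probability space with the measurable
    sets of \<open>S\<close>; \<open>S\<close> itself only supplies a sigma-algebra and may be
    infinite, as \<open>borel\<close> is not a law.\<close>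
  have "PiM I (\<lambda>_. ?D) = PiM I (\<lambda>_. distr (M \<Otimes>\<^sub>M N) ?D h)"
    by (intro PiM_cong distr_cong) auto
  also have "\<dots> = distr (PiM I ?MN) (PiM I (\<lambda>_. ?D)) (compose I h)"
    using I h h' by (intro distr_PiM_finite_prob_space'[symmetric] MN.prob_space_axioms MN.prob_space_distr) auto
  also have "\<dots> = distr (PiM I ?MN) (PiM I (\<lambda>_. S)) (compose I h)"
    using S by (intro distr_cong) auto
  also have "\<dots> = distr (distr (PiM I (\<lambda>_. M) \<Otimes>\<^sub>M PiM I (\<lambda>_. N)) (PiM I ?MN) (\<lambda>(f, g). \<lambda>i\<in>I. (f i, g i)))
      (PiM I (\<lambda>_. S)) (compose I h)"
    using distr_PiM_zip[OF I, of "\<lambda>_. M" "\<lambda>_. N"] M N by simp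
  also have "\<dots> = distr (PiM I (\<lambda>_. M) \<Otimes>\<^sub>M PiM I (\<lambda>_. N)) (PiM I (\<lambda>_. S)) (compose I h \<circ> (\<lambda>(f, g). \<lambda>i\<in>I. (f i, g i)))"
    by (rule distr_distr[OF comp zip])
  also have "compose I h \<circ> (\<lambda>(f, g). \<lambda>i\<in>I. (f i, g i)) = (\<lambda>(f, g). \<lambda>i\<in>I. h (f i, g i))"
    by (auto simp: fun_eq_iff compose_def)
  finally show ?thesis ..
qed

text \<open>Curried, the matrix together with the noise is a family of independent pairs of a row
  and a noise entry. \<open>row_regression\<close> replaces the law of each such pair, and the
  result is unzipped into two independent vectors \<open>Z\<close> and \<open>Y\<close>.\<close>

lemma model_regression:
  fixes b :: "nat \<Rightarrow> real" and \<sigma> :: real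
  assumes "\<sigma> > 0" "j < p"
  defines "\<tau> \<equiv> sqrt (\<sigma>\<^sup>2 + (\<Sum>l\<in>{..<p} - {j}. (b l)\<^sup>2))"
    and "s \<equiv> sqrt (\<sigma>\<^sup>2 + (\<Sum>l<p. (b l)\<^sup>2))"
  shows "distr (PiM ({..<n} \<times> {..<p}) (\<lambda>_. gaussian 1) \<Otimes>\<^sub>M PiM {..<n} (\<lambda>_. gaussian \<sigma>))
      (PiM {..<n} (\<lambda>_. borel \<Otimes>\<^sub>M borel)) (\<lambda>(X, w). \<lambda>i\<in>{..<n}. (X (i, j), response p X w b i)) =
    distr (PiM {..<n} (\<lambda>_. gaussian (\<tau> / s)) \<Otimes>\<^sub>M PiM {..<n} (\<lambda>_. gaussian s))
      (PiM {..<n} (\<lambda>_. borel \<Otimes>\<^sub>M borel)) (\<lambda>(Z, Y). \<lambda>i\<in>{..<n}. (Z i + b j / s\<^sup>2 * Y i, Y i))"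
proof -
  let ?I = "{..<n}" and ?B = "borel \<Otimes>\<^sub>M borel :: (real \<times> real) measure"
  let ?Row = "PiM {..<p} (\<lambda>_. gaussian 1)"
  let ?X = "PiM (?I \<times> {..<p}) (\<lambda>_. gaussian 1)" and ?W = "PiM ?I (\<lambda>_. gaussian \<sigma>)"
  let ?curry = "\<lambda>X. \<lambda>i\<in>?I. \<lambda>l\<in>{..<p}. X (i, l)"
  define h where "h = (\<lambda>(x, u). (x j, (\<Sum>l<p. x l * b l) + u) :: real \<times> real)"
  define H where "H = (\<lambda>(f, g). \<lambda>i\<in>?I. h (f i, g i))"
  have \<tau>s: "\<tau> > 0" "s > 0"
    using assms by (auto simp: \<tau>_def s_def intro!: add_pos_nonneg sum_nonneg)
  have j: "j \<in> {..<p}" using assms by simp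
  have h: "h \<in> ?Row \<Otimes>\<^sub>M gaussian \<sigma> \<rightarrow>\<^sub>M ?B"
    unfolding h_def using j by measurable
  have Row: "prob_space ?Row" by (intro prob_space_PiM prob_space_gaussian) auto
  have \<sigma>: "prob_space (gaussian \<sigma>)" using assms by (intro prob_space_gaussian)
  interpret W: prob_space ?W using \<sigma> by (intro prob_space_PiM)
  have H: "H \<in> PiM ?I (\<lambda>_. ?Row) \<Otimes>\<^sub>M ?W \<rightarrow>\<^sub>M PiM ?I (\<lambda>_. ?B)"
    unfolding H_def split_beta
    by (rule measurable_restrict) (auto intro!: measurable_compose[OF _ h])
  have curry: "?curry \<in> ?X \<rightarrow>\<^sub>M PiM ?I (\<lambda>_. ?Row)"
    by (intro measurable_restrict) auto
  have map_curry: "(\<lambda>(X, w). (?curry X, w)) \<in> ?X \<Otimes>\<^sub>M ?W \<rightarrow>\<^sub>M PiM ?I (\<lambda>_. ?Row) \<Otimes>\<^sub>M ?W"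
    using curry by measurable
  have "distr (?X \<Otimes>\<^sub>M ?W) (PiM ?I (\<lambda>_. ?B)) (\<lambda>(X, w). \<lambda>i\<in>?I. (X (i, j), response p X w b i)) =
     distr (?X \<Otimes>\<^sub>M ?W) (PiM ?I (\<lambda>_. ?B)) (H \<circ> (\<lambda>(X, w). (?curry X, w)))"
    using assms(2) by (intro arg_cong[where f = "distr _ _"]) (auto simp: H_def h_def fun_eq_iff response_def)
  also have "\<dots> = distr (distr (?X \<Otimes>\<^sub>M ?W) (PiM ?I (\<lambda>_. ?Row) \<Otimes>\<^sub>M ?W) (\<lambda>(X, w). (?curry X, w))) (PiM ?I (\<lambda>_. ?B)) H"
    by (rule distr_distr[OF H map_curry, symmetric])
  also have "distr (?X \<Otimes>\<^sub>M ?W) (PiM ?I (\<lambda>_. ?Row) \<Otimes>\<^sub>M ?W) (\<lambda>(X, w). (?curry X, w)) =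
      distr ?X (PiM ?I (\<lambda>_. ?Row)) ?curry \<Otimes>\<^sub>M distr ?W ?W (\<lambda>w. w)"
    by (rule pair_measure_distr[symmetric, OF curry]) (auto simp: distr_id W.sigma_finite_measure_axioms)
  also have "\<dots> = PiM ?I (\<lambda>_. ?Row) \<Otimes>\<^sub>M ?W"
    using distr_PiM_curry[of ?I "{..<p}" "\<lambda>_. gaussian 1"] by (simp add: distr_id prob_space_gaussian)
  also have "distr \<dots> (PiM ?I (\<lambda>_. ?B)) H = PiM ?I (\<lambda>_. distr (?Row \<Otimes>\<^sub>M gaussian \<sigma>) ?B h)"
    unfolding H_def by (rule distr_PiM_pair_map[OF _ Row \<sigma> h]) simp
  also have "distr (?Row \<Otimes>\<^sub>M gaussian \<sigma>) ?B h =
      distr (gaussian (\<tau> / s) \<Otimes>\<^sub>M gaussian s) ?B (\<lambda>(z, y). (z + b j / s\<^sup>2 * y, y))"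
    unfolding h_def \<tau>_def s_def by (rule row_regression[OF assms(1,2)])
  also have "PiM ?I (\<lambda>_. \<dots>) = distr (PiM ?I (\<lambda>_. gaussian (\<tau> / s)) \<Otimes>\<^sub>M PiM ?I (\<lambda>_. gaussian s))
      (PiM ?I (\<lambda>_. ?B)) (\<lambda>(Z, Y). \<lambda>i\<in>?I. (case (Z i, Y i) of (z, y) \<Rightarrow> (z + b j / s\<^sup>2 * y, y)))"
    using \<tau>s by (intro distr_PiM_pair_map[symmetric] prob_space_gaussian) auto
  finally show ?thesis by (simp only: prod.case)
qed

subsection \<open>Tail bounds\<close>

text \<open>Exponential Markov inequality: on \<open>A\<close> the exponential of the sum minus
  \<open>a\<close> is at least 1, and by independence its integral factors over the
  coordinates.\<close>

lemma PiM_Chernoff: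
  assumes I: "finite I" and M: "\<And>i. prob_space (M i)"
    and f [measurable]: "\<And>i. i \<in> I \<Longrightarrow> f i \<in> borel_measurable (M i)"
    and A: "A \<in> sets (PiM I M)" and le: "\<And>x. x \<in> A \<Longrightarrow> a \<le> (\<Sum>i\<in>I. f i (x i))"
  shows "emeasure (PiM I M) A \<le> ennreal (exp (- a)) * (\<Prod>i\<in>I. \<integral>\<^sup>+x. ennreal (exp (f i x)) \<partial>M i)"
proof -
  interpret product_prob_space M I using M by (intro product_prob_spaceI)
  have "emeasure (PiM I M) A = (\<integral>\<^sup>+x. indicator A x \<partial>PiM I M)"
    using A by simp
  also have "\<dots> \<le> (\<integral>\<^sup>+x. ennreal (exp (- a)) * (\<Prod>i\<in>I. ennreal (exp (f i (x i)))) \<partial>PiM I M)"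
  proof (rule nn_integral_mono)
    fix x
    have "(1 :: real) \<le> exp (- a) * exp (\<Sum>i\<in>I. f i (x i))" if "x \<in> A"
      using le[OF that] by (simp flip: exp_add)
    then have "indicator A x \<le> ennreal (exp (- a) * exp (\<Sum>i\<in>I. f i (x i)))"
      by (auto simp: indicator_def)
    also have "\<dots> = ennreal (exp (- a)) * (\<Prod>i\<in>I. ennreal (exp (f i (x i))))"
      using I by (simp add: ennreal_mult exp_sum prod_ennreal prod_nonneg)
    finally show "indicator A x \<le> ennreal (exp (- a)) * (\<Prod>i\<in>I. ennreal (exp (f i (x i))))" .
  qed
  also have "\<dots> = ennreal (exp (- a)) * (\<integral>\<^sup>+x. (\<Prod>i\<in>I. ennreal (exp (f i (x i)))) \<partial>PiM I M)"
    by (rule nn_integral_cmult) measurable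
  also have "(\<integral>\<^sup>+x. (\<Prod>i\<in>I. ennreal (exp (f i (x i)))) \<partial>PiM I M) = (\<Prod>i\<in>I. \<integral>\<^sup>+x. ennreal (exp (f i x)) \<partial>M i)"
    using I by (intro product_nn_integral_prod) auto
  finally show ?thesis .
qed

text \<open>For fixed \<open>y\<close> the inner product is a centred Gaussian with standard
  deviation at most \<open>l2 n y\<close>, since \<open>\<nu> \<le> 1\<close>. The upper tail is
  obtained by applying the bound to \<open>- y\<close>.\<close>

lemma gaussian_inner_lower_tail:
  assumes "0 < \<nu>" "\<nu> \<le> 1" "t > 0" "l2 n y > 0"
  shows "emeasure (PiM {..<n} (\<lambda>_. gaussian \<nu>))
      {z \<in> space (PiM {..<n} (\<lambda>_. gaussian \<nu>)). (\<Sum>i<n. z i * y i) \<le> - t * l2 n y} \<le> ennreal (exp (- t\<^sup>2 / 2))"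
proof -
  define L where "L = l2 n y"
  \<comment> \<open>This parameter minimises the Chernoff exponent when
    \<open>\<nu> = 1\<close>.\<close>
  define \<theta> where "\<theta> = t / L"
  have L: "L > 0" "L\<^sup>2 = (\<Sum>i<n. (y i)\<^sup>2)"
    using assms by (auto simp: L_def L2_set_def sum_nonneg)
  have \<theta>: "\<theta> > 0" "\<theta> * L = t" using L assms by (auto simp: \<theta>_def)
  let ?M = "PiM {..<n} (\<lambda>_. gaussian \<nu>)"
  have "emeasure ?M {z \<in> space ?M. (\<Sum>i<n. z i * y i) \<le> - t * L}
    \<le> ennreal (exp (- (\<theta> * t * L))) * (\<Prod>i<n. \<integral>\<^sup>+x. ennreal (exp ((- \<theta> * y i) * x)) \<partial>gaussian \<nu>)"
  proof (rule PiM_Chernoff)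
    fix z assume "z \<in> {z \<in> space ?M. (\<Sum>i<n. z i * y i) \<le> - t * L}"
    then have "\<theta> * (\<Sum>i<n. z i * y i) \<le> \<theta> * (- t * L)"
      using \<theta>(1) by (intro mult_left_mono) auto
    moreover have "(\<Sum>i<n. - \<theta> * y i * z i) = - (\<theta> * (\<Sum>i<n. z i * y i))"
      by (simp add: sum_distrib_left sum_negf[symmetric] mult_ac)
    ultimately show "\<theta> * t * L \<le> (\<Sum>i<n. - \<theta> * y i * z i)"
      by (simp add: mult_ac)
  qed (use assms in \<open>auto intro: prob_space_gaussian\<close>)
  also have "(\<Prod>i<n. \<integral>\<^sup>+x. ennreal (exp ((- \<theta> * y i) * x)) \<partial>gaussian \<nu>) =
      ennreal (exp (\<theta>\<^sup>2 * \<nu>\<^sup>2 / 2 * L\<^sup>2))"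
    unfolding gaussian_exp_linear[OF assms(1)]
    by (simp add: prod_ennreal exp_sum[symmetric] L(2) sum_distrib_left power_mult_distrib mult_ac)
  also have "ennreal (exp (- (\<theta> * t * L))) * ennreal (exp (\<theta>\<^sup>2 * \<nu>\<^sup>2 / 2 * L\<^sup>2)) =
      ennreal (exp (- t\<^sup>2 + t\<^sup>2 * \<nu>\<^sup>2 / 2))"
  proof -
    have "\<theta> * t * L = t\<^sup>2" using \<theta>(2) by (simp add: power2_eq_square mult_ac)
    moreover have "\<theta>\<^sup>2 * \<nu>\<^sup>2 / 2 * L\<^sup>2 = t\<^sup>2 * \<nu>\<^sup>2 / 2"
      by (simp add: \<theta>(2)[symmetric] power_mult_distrib)
    ultimately show ?thesis by (simp only: exp_add ennreal_mult exp_ge_zero)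
  qed
  also have "\<dots> \<le> ennreal (exp (- t\<^sup>2 / 2))"
  proof -
    have "\<nu>\<^sup>2 \<le> 1" using assms by (simp add: power_le_one)
    then have "t\<^sup>2 * \<nu>\<^sup>2 \<le> t\<^sup>2 * 1" by (intro mult_left_mono) auto
    then show ?thesis by (intro ennreal_leI) simp
  qed
  finally show ?thesis by (simp add: L_def)
qed

text \<open>The exponent of the Chernoff bound comes from the optimal parameter \<open>\<kappa> = (1 / q - 1) / 2\<close>.\<close>

lemma gaussian_norm_lower_tail:
  assumes "s > 0" "0 < q" "q < 1"
  shows "emeasure (PiM {..<n} (\<lambda>_. gaussian s))
      {y \<in> space (PiM {..<n} (\<lambda>_. gaussian s)). (\<Sum>i<n. (y i)\<^sup>2) < q * s\<^sup>2 * real n}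
    \<le> ennreal (exp (- ((q - 1 - ln q) / 2) * real n))"
proof -
  define \<kappa> where "\<kappa> = (1 / q - 1) / 2"
  have \<kappa>: "\<kappa> > 0" "1 + 2 * \<kappa> = 1 / q" "\<kappa> * q = (1 - q) / 2"
    using assms by (auto simp: \<kappa>_def field_simps)
  let ?M = "PiM {..<n} (\<lambda>_. gaussian s)"
  have "emeasure ?M {y \<in> space ?M. (\<Sum>i<n. (y i)\<^sup>2) < q * s\<^sup>2 * real n}
    \<le> ennreal (exp (- (- \<kappa> * q * real n))) * (\<Prod>i<n. \<integral>\<^sup>+x. ennreal (exp (- \<kappa> * x\<^sup>2 / s\<^sup>2)) \<partial>gaussian s)"
  proof (rule PiM_Chernoff)
    fix y assume "y \<in> {y \<in> space ?M. (\<Sum>i<n. (y i)\<^sup>2) < q * s\<^sup>2 * real n}"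
    then have "\<kappa> / s\<^sup>2 * (\<Sum>i<n. (y i)\<^sup>2) \<le> \<kappa> / s\<^sup>2 * (q * s\<^sup>2 * real n)"
      using \<kappa> by (intro mult_left_mono) auto
    moreover have "(\<Sum>i<n. - \<kappa> * (y i)\<^sup>2 / s\<^sup>2) = - (\<kappa> / s\<^sup>2 * (\<Sum>i<n. (y i)\<^sup>2))"
      by (simp add: sum_distrib_left sum_negf[symmetric])
    moreover have "\<kappa> / s\<^sup>2 * (q * s\<^sup>2 * real n) = \<kappa> * q * real n" using assms by simp
    ultimately show "- \<kappa> * q * real n \<le> (\<Sum>i<n. - \<kappa> * (y i)\<^sup>2 / s\<^sup>2)" by simp
  qed (use assms in \<open>auto intro: prob_space_gaussian\<close>)
  also have "\<dots> = ennreal (exp ((1 - q) / 2 * real n)) * ennreal (sqrt q) ^ n"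
  proof -
    \<comment> \<open>With this \<open>\<kappa>\<close> one has
      \<open>1 + 2 * \<kappa> = 1 / q\<close>, so every coordinate contributes the factor
      \<open>sqrt q\<close>, the source of the logarithm in the rate.\<close>
    have "(\<integral>\<^sup>+x. ennreal (exp (- \<kappa> * x\<^sup>2 / s\<^sup>2)) \<partial>gaussian s) = ennreal (sqrt q)"
      using gaussian_exp_square[of s \<kappa>] assms \<kappa> by (simp add: real_sqrt_divide)
    moreover have "- (- \<kappa> * q * real n) = (1 - q) / 2 * real n"
      using \<kappa>(3) by simp
    ultimately show ?thesis by (simp only: prod_constant card_lessThan)
  qed
  also have "sqrt q = exp (ln q / 2)"
    using assms by (simp add: ln_sqrt[symmetric])
  also have "ennreal (exp ((1 - q) / 2 * real n)) * ennreal (exp (ln q / 2)) ^ n =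
      ennreal (exp ((1 - q) / 2 * real n) * exp (ln q / 2) ^ n)"
    by (simp add: ennreal_power ennreal_mult)
  also have "exp ((1 - q) / 2 * real n) * exp (ln q / 2) ^ n = exp (- ((q - 1 - ln q) / 2) * real n)"
    by (simp add: exp_of_nat_mult[symmetric] exp_add[symmetric] field_simps)
  finally show ?thesis .
qed

text \<open>Conditioning on the second component: a bound that is uniform over the sections survives
  averaging. Here the response is frozen and only the residual is random.\<close>

lemma emeasure_pair_le:
  assumes "prob_space M" "prob_space N" and A: "A \<in> sets (M \<Otimes>\<^sub>M N)"
    and le: "\<And>y. y \<in> space N \<Longrightarrow> emeasure M {x \<in> space M. (x, y) \<in> A} \<le> c"
  shows "emeasure (M \<Otimes>\<^sub>M N) A \<le> c"
proof -
  interpret M: prob_space M by fact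
  interpret N: prob_space N by fact
  interpret pair_prob_space M N ..
  have "emeasure (M \<Otimes>\<^sub>M N) A = (\<integral>\<^sup>+y. emeasure M ((\<lambda>x. (x, y)) -` A) \<partial>N)"
    by (rule emeasure_pair_measure_alt2[OF A])
  also have "\<dots> \<le> (\<integral>\<^sup>+y. c \<partial>N)"
  proof (rule nn_integral_mono)
    fix y assume "y \<in> space N"
    moreover have "(\<lambda>x. (x, y)) -` A = {x \<in> space M. (x, y) \<in> A}"
      using sets.sets_into_space[OF A] by (auto simp: space_pair_measure)
    ultimately show "emeasure M ((\<lambda>x. (x, y)) -` A) \<le> c" using le by simp
  qed
  also have "\<dots> = c" by (simp add: N.emeasure_space_1)
  finally show ?thesis .
qed

section \<open>Deterministic analysis of the estimator\<close>

text \<open>Coordinate \<open>j\<close> of the estimator reads only column \<open>j\<close> and the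
  first \<open>n\<close> entries of the response. Hence a single column can stand in for the whole
  matrix, and restricting functions to \<open>{..<n}\<close> does no harm.\<close>

lemma beta_hat_cong:
  assumes "\<And>i. i < n \<Longrightarrow> X (i, j) = X' (i, j)" "\<And>i. i < n \<Longrightarrow> y i = y' i"
  shows "beta_hat \<epsilon> n p X y j = beta_hat \<epsilon> n p X' y' j"
proof -
  have "l2 n y = l2 n y'" using assms by (intro L2_set_cong) auto
  moreover have "(\<Sum>i<n. X (i, j) * y i) = (\<Sum>i<n. X' (i, j) * y' i)"
    using assms by (intro sum.cong) auto
  ultimately show ?thesis by (simp add: beta_hat_def correlation_def)
qed

text \<open>If \<open>y = 0\<close> the correlation is \<open>0 / 0 = 0\<close>, which stays below the threshold.\<close>

lemma beta_hat_null_error: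
  fixes z y :: "nat \<Rightarrow> real" and \<epsilon> :: real and p :: nat
  defines "t \<equiv> sqrt (2 * (1 + \<epsilon> / 2) * ln (2 * real p))"
  assumes t: "t > 0" and err: "beta_hat \<epsilon> n p (\<lambda>(i, l). z i) y j \<noteq> 0"
  shows "l2 n y > 0 \<and> ((\<Sum>i<n. z i * y i) \<le> - t * l2 n y \<or> (\<Sum>i<n. z i * - y i) \<le> - t * l2 n y)"
proof -
  define S L where "S = (\<Sum>i<n. z i * y i)" and "L = l2 n y"
  have corr: "\<bar>S / L\<bar> \<ge> t"
    using err unfolding beta_hat_def correlation_def t_def S_def L_def by (auto split: if_splits)
  then have "L \<noteq> 0" using t by auto
  then have L: "L > 0" by (simp add: L_def L2_set_nonneg order_less_le)
  then have "S \<le> - t * L \<or> - S \<le> - t * L"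
    using corr by (auto simp: abs_if field_simps split: if_splits)
  then show ?thesis using L by (simp add: S_def L_def sum_negf)
qed

text \<open>The deterministic part of the correlation is at least twice the threshold.\<close>

lemma beta_hat_support_error:
  fixes z y :: "nat \<Rightarrow> real" and \<epsilon> :: real and p :: nat
  defines "t \<equiv> sqrt (2 * (1 + \<epsilon> / 2) * ln (2 * real p))"
  assumes t: "t > 0" and s: "s > 0" and q: "q > 0" and n: "n > 0" and b: "b \<noteq> 0"
    and strong: "4 * t\<^sup>2 \<le> b\<^sup>2 * q * real n / s\<^sup>2"
    and norm: "q * s\<^sup>2 * real n \<le> (\<Sum>i<n. (y i)\<^sup>2)"
    and err: "beta_hat \<epsilon> n p (\<lambda>(i, l). z i + b / s\<^sup>2 * y i) y j \<noteq> sgn b"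
  shows "l2 n y > 0 \<and> (\<Sum>i<n. z i * (sgn b * y i)) \<le> - t * l2 n y"
proof -
  define S L C where "S = (\<Sum>i<n. z i * y i)" and "L = l2 n y"
    and "C = correlation n (\<lambda>(i, l). z i + b / s\<^sup>2 * y i) y j"
  have L2: "L\<^sup>2 = (\<Sum>i<n. (y i)\<^sup>2)" by (simp add: L_def L2_set_def sum_nonneg)
  have "0 < q * s\<^sup>2 * real n" using q s n by simp
  then have "L\<^sup>2 > 0" using norm L2 by simp
  then have L: "L > 0" by (simp add: L_def L2_set_nonneg order_less_le)
  have "(\<Sum>i<n. (z i + b / s\<^sup>2 * y i) * y i) = S + b / s\<^sup>2 * L\<^sup>2"
  proof -
    have "(z i + b / s\<^sup>2 * y i) * y i = z i * y i + b / s\<^sup>2 * (y i)\<^sup>2" for i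
      by (simp add: algebra_simps power2_eq_square)
    then show ?thesis by (simp only: S_def L2 sum.distrib sum_distrib_left)
  qed
  then have "C = (S + b / s\<^sup>2 * L\<^sup>2) / L" by (simp add: C_def correlation_def L_def)
  then have C: "C = S / L + b / s\<^sup>2 * L"
    using L by (simp add: add_divide_distrib power2_eq_square)
  \<comment> \<open>The norm bound controls \<open>L\<^sup>2\<close>, so the drift is compared with
    \<open>2 * t\<close> through squares.\<close>
  have "(2 * t)\<^sup>2 \<le> b\<^sup>2 * q * real n / s\<^sup>2"
    using strong by (simp add: power_mult_distrib)
  also have "\<dots> = (\<bar>b\<bar> / s\<^sup>2)\<^sup>2 * (q * s\<^sup>2 * real n)"
    using s by (simp add: power_divide power2_eq_square)
  also have "\<dots> \<le> (\<bar>b\<bar> / s\<^sup>2)\<^sup>2 * L\<^sup>2"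
    using norm L2 by (intro mult_left_mono) auto
  also have "\<dots> = (\<bar>b\<bar> / s\<^sup>2 * L)\<^sup>2" by (rule power_mult_distrib[symmetric])
  finally have drift: "2 * t \<le> \<bar>b\<bar> / s\<^sup>2 * L"
    by (rule power2_le_imp_le) (use L in auto)
  have "sgn b * S \<le> - t * L"
  proof (rule ccontr)
    assume "\<not> ?thesis"
    then have "- t * L < sgn b * S" by simp
    then have "- t < sgn b * S / L" using L by (simp add: field_simps)
    moreover have "sgn b * C = sgn b * S / L + \<bar>b\<bar> / s\<^sup>2 * L"
      unfolding C by (simp add: algebra_simps abs_sgn)
    ultimately have "t < sgn b * C" using drift by linarith
    \<comment> \<open>Since \<open>sgn b * C\<close> exceeds the positive number \<open>t\<close>,
      the threshold test and the sign are both correct.\<close>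
    then have "\<bar>C\<bar> \<ge> t \<and> sgn C = sgn b"
      using t b by (auto simp: sgn_if split: if_splits)
    then have "beta_hat \<epsilon> n p (\<lambda>(i, l). z i + b / s\<^sup>2 * y i) y j = sgn b"
      unfolding beta_hat_def C_def[symmetric] t_def by simp
    with err show False by contradiction
  qed
  then show ?thesis using L by (simp add: S_def L_def sum_distrib_left mult_ac)
qed

subsection \<open>Errors for a fixed signal\<close>

lemma measurable_l2:
  assumes [measurable]: "\<And>i. i < n \<Longrightarrow> (\<lambda>\<omega>. y \<omega> i) \<in> borel_measurable M"
  shows "(\<lambda>\<omega>. l2 n (y \<omega>)) \<in> borel_measurable M"
  unfolding L2_set_def by measurable

lemma measurable_beta_hat:
  assumes [measurable]: "\<And>i. i < n \<Longrightarrow> (\<lambda>\<omega>. X \<omega> (i, j)) \<in> borel_measurable M"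
    and y [measurable]: "\<And>i. i < n \<Longrightarrow> (\<lambda>\<omega>. y \<omega> i) \<in> borel_measurable M"
  shows "(\<lambda>\<omega>. beta_hat \<epsilon> n p (X \<omega>) (y \<omega>) j) \<in> borel_measurable M"
proof -
  have [measurable]: "(\<lambda>\<omega>. correlation n (X \<omega>) (y \<omega>) j) \<in> borel_measurable M"
    unfolding correlation_def
    by (intro borel_measurable_divide borel_measurable_sum borel_measurable_times measurable_l2) auto
  show ?thesis unfolding beta_hat_def by measurable
qed

lemma measurable_response:
  assumes "\<And>l. l < p \<Longrightarrow> (\<lambda>\<omega>. X \<omega> (i, l)) \<in> borel_measurable M"
    and "\<And>l. l < p \<Longrightarrow> (\<lambda>\<omega>. b \<omega> l) \<in> borel_measurable M"
    and "(\<lambda>\<omega>. w \<omega> i) \<in> borel_measurable M"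
  shows "(\<lambda>\<omega>. response p (X \<omega>) (w \<omega>) (b \<omega>) i) \<in> borel_measurable M"
  unfolding response_def using assms
  by (intro borel_measurable_add borel_measurable_sum borel_measurable_times) auto

lemma measurable_PiM_borel_component:
  assumes "i \<in> I" "sets N = sets (PiM I (\<lambda>_. borel))" "f \<in> M \<rightarrow>\<^sub>M N"
  shows "(\<lambda>\<omega>. f \<omega> i) \<in> borel_measurable M"
proof -
  have "(\<lambda>x. x i) \<in> N \<rightarrow>\<^sub>M borel"
    using assms(1) by (subst measurable_cong_sets[OF assms(2) refl]) (rule measurable_component_singleton)
  with assms(3) show ?thesis by (rule measurable_compose)
qed

lemma sets_PiM_gaussian: "sets (PiM I (\<lambda>_. gaussian \<sigma>)) = sets (PiM I (\<lambda>_. borel))"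
  by (intro sets_PiM_cong) auto

section \<open>Error probabilities for one column and for all columns\<close>

text \<open>The error event depends only on column \<open>j\<close> and the response, so
  \<open>model_regression\<close> moves it to the independent pair of residual and response. For
  \<open>b j = 0\<close> an error forces a deviation of the residual term to one of two sides;
  otherwise it forces a deviation against the sign of \<open>b j\<close> or a small response. This
  explains the two summands.\<close>

lemma column_error:
  fixes b :: "nat \<Rightarrow> real" and \<sigma> \<epsilon> q :: real and n p :: nat
  defines "s \<equiv> sqrt (\<sigma>\<^sup>2 + (\<Sum>l<p. (b l)\<^sup>2))"
    and "t \<equiv> sqrt (2 * (1 + \<epsilon> / 2) * ln (2 * real p))"
    and "V \<equiv> PiM ({..<n} \<times> {..<p}) (\<lambda>_. gaussian 1) \<Otimes>\<^sub>M PiM {..<n} (\<lambda>_. gaussian \<sigma>)"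
  assumes \<sigma>: "\<sigma> > 0" and j: "j < p" and n: "n > 0" and q: "0 < q" "q < 1" and t: "t > 0"
    and strong: "b j \<noteq> 0 \<Longrightarrow> 4 * t\<^sup>2 \<le> (b j)\<^sup>2 * q * real n / s\<^sup>2"
  shows "emeasure V {(X, w) \<in> space V. beta_hat \<epsilon> n p X (response p X w b) j \<noteq> sgn (b j)} \<le>
    ennreal (exp (- t\<^sup>2 / 2) +
      (if b j = 0 then exp (- t\<^sup>2 / 2) else exp (- ((q - 1 - ln q) / 2) * real n)))"
proof -
  define \<tau> where "\<tau> = sqrt (\<sigma>\<^sup>2 + (\<Sum>l\<in>{..<p} - {j}. (b l)\<^sup>2))"
  have \<tau>s: "\<tau> > 0" "s > 0"
    using \<sigma> by (auto simp: \<tau>_def s_def intro!: add_pos_nonneg sum_nonneg)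
  have "(\<Sum>l\<in>{..<p} - {j}. (b l)\<^sup>2) \<le> (\<Sum>l<p. (b l)\<^sup>2)"
    by (intro sum_mono2) auto
  then have "\<tau> \<le> s" by (simp add: \<tau>_def s_def)
  then have \<nu>: "0 < \<tau> / s" "\<tau> / s \<le> 1" using \<tau>s by auto
  let ?Z = "PiM {..<n} (\<lambda>_. gaussian (\<tau> / s))" and ?Y = "PiM {..<n} (\<lambda>_. gaussian s)"
  let ?W = "?Z \<Otimes>\<^sub>M ?Y"
  let ?S = "PiM {..<n} (\<lambda>_. borel \<Otimes>\<^sub>M borel) :: (nat \<Rightarrow> real \<times> real) measure"
  let ?c = "exp (- t\<^sup>2 / 2)"
  have Z: "prob_space ?Z" using \<nu> by (intro prob_space_PiM prob_space_gaussian)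
  have Y: "prob_space ?Y" using \<tau>s by (intro prob_space_PiM prob_space_gaussian)
  interpret Z: prob_space ?Z by (rule Z)
  interpret Y: prob_space ?Y by (rule Y)
  \<comment> \<open>Writes the estimator as a function of the pairs of column entry and response
    entry, the data whose law \<open>model_regression\<close> describes.\<close>
  define test where "test g = beta_hat \<epsilon> n p (\<lambda>(i, l). fst (g i)) (\<lambda>i. snd (g i)) j"
    for g :: "nat \<Rightarrow> real \<times> real"
  define f where "f = (\<lambda>(X, w). \<lambda>i\<in>{..<n}. (X (i, j) :: real, response p X w b i))"
  define g where "g = (\<lambda>(z, y). \<lambda>i\<in>{..<n}. (z i + b j / s\<^sup>2 * y i, y i))"
  define B where "B = {x \<in> space ?S. test x \<noteq> sgn (b j)}"
  define bad where "bad = {(z, y) \<in> space ?W. beta_hat \<epsilon> n p (\<lambda>(i, l). z i + b j / s\<^sup>2 * y i) y j \<noteq> sgn (b j)}"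
  \<comment> \<open>One-sided deviation along \<open>c * y\<close>. Taking \<open>c\<close> to be a
    sign lets a single lower-tail bound serve both tails as well as both signs of
    \<open>b j\<close>.\<close>
  define E where "E c = {x \<in> space ?W. l2 n (snd x) > 0 \<and> (\<Sum>i<n. fst x i * (c * snd x i)) \<le> - t * l2 n (snd x)}" for c :: real
  have test [measurable]: "test \<in> borel_measurable ?S"
    unfolding test_def by (intro measurable_beta_hat) measurable
  have B: "B \<in> sets ?S" unfolding B_def by measurable
  have f: "f \<in> V \<rightarrow>\<^sub>M ?S"
    unfolding f_def V_def response_def split_beta
    using j by (intro measurable_restrict) measurable
  have g: "g \<in> ?W \<rightarrow>\<^sub>M ?S"
    unfolding g_def split_beta by (intro measurable_restrict) measurable
  have zy: "(\<lambda>x. fst x i) \<in> borel_measurable ?W" "(\<lambda>x. snd x i) \<in> borel_measurable ?W" if "i < n" for i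
    using that by (auto intro!: measurable_PiM_borel_component[of _ _ _ fst, OF _ sets_PiM_gaussian]
        measurable_PiM_borel_component[of _ _ _ snd, OF _ sets_PiM_gaussian])
  have E_sets [measurable]: "E c \<in> sets ?W" for c
    unfolding E_def using zy
    by (intro sets.sets_Collect_conj borel_measurable_less borel_measurable_le borel_measurable_times
        borel_measurable_sum measurable_l2 borel_measurable_const) auto
  have E: "emeasure ?W (E c) \<le> ennreal ?c" if "\<bar>c\<bar> = 1" for c
  proof (rule emeasure_pair_le[OF Z Y E_sets])
    fix y assume y: "y \<in> space ?Y"
    have l2: "l2 n (\<lambda>i. c * y i) = l2 n y"
    proof -
      have "c\<^sup>2 = 1" using that by (simp add: abs_square_eq_1)
      then show ?thesis by (simp add: L2_set_def power_mult_distrib)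
    qed
    show "emeasure ?Z {x \<in> space ?Z. (x, y) \<in> E c} \<le> ennreal ?c"
    proof (cases "l2 n y > 0")
      case True
      then have "{x \<in> space ?Z. (x, y) \<in> E c} =
          {x \<in> space ?Z. (\<Sum>i<n. x i * (c * y i)) \<le> - t * l2 n (\<lambda>i. c * y i)}"
        using y by (auto simp: E_def space_pair_measure l2)
      then show ?thesis
        using gaussian_inner_lower_tail[OF \<nu> t, where n = n and y = "\<lambda>i. c * y i"] True l2 by simp
    qed (auto simp: E_def)
  qed
  have "{(X, w) \<in> space V. beta_hat \<epsilon> n p X (response p X w b) j \<noteq> sgn (b j)} = f -` B \<inter> space V"
  proof -
    have "test (f (X, w)) = beta_hat \<epsilon> n p X (response p X w b) j" for X w
      unfolding test_def f_def by (intro beta_hat_cong) auto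
    then show ?thesis using measurable_space[OF f] by (auto simp: B_def)
  qed
  then have "emeasure V {(X, w) \<in> space V. beta_hat \<epsilon> n p X (response p X w b) j \<noteq> sgn (b j)} =
      emeasure (distr V ?S f) B"
    using f B by (simp add: emeasure_distr)
  also have "distr V ?S f = distr ?W ?S g"
    unfolding V_def f_def g_def \<tau>_def s_def by (rule model_regression[OF \<sigma> j])
  also have "emeasure \<dots> B = emeasure ?W (g -` B \<inter> space ?W)"
    using g B by (simp add: emeasure_distr)
  also have "g -` B \<inter> space ?W = bad"
  proof -
    have "test (g (z, y)) = beta_hat \<epsilon> n p (\<lambda>(i, l). z i + b j / s\<^sup>2 * y i) y j" for z y
      unfolding test_def g_def by (intro beta_hat_cong) auto
    then show ?thesis using measurable_space[OF g] by (auto simp: B_def bad_def)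
  qed
  also have "emeasure ?W bad \<le> ennreal (?c + (if b j = 0 then ?c else exp (- ((q - 1 - ln q) / 2) * real n)))"
  proof (cases "b j = 0")
    case True
    have "bad \<subseteq> E 1 \<union> E (- 1)"
    proof
      fix x assume x: "x \<in> bad"
      obtain z y where zy: "x = (z, y)" by (cases x)
      have "beta_hat \<epsilon> n p (\<lambda>(i, l). z i) y j \<noteq> 0"
        using x True by (simp add: bad_def zy)
      from beta_hat_null_error[OF t[unfolded t_def] this, folded t_def] x
      show "x \<in> E 1 \<union> E (- 1)" by (simp add: bad_def E_def zy)
    qed
    then have "emeasure ?W bad \<le> emeasure ?W (E 1 \<union> E (- 1))"
      by (rule emeasure_mono) measurable
    also have "\<dots> \<le> emeasure ?W (E 1) + emeasure ?W (E (- 1))"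
      by (rule emeasure_subadditive) measurable
    also have "\<dots> \<le> ennreal ?c + ennreal ?c" by (intro add_mono E) auto
    finally show ?thesis using True by (simp flip: ennreal_plus)
  next
    case False
    let ?N = "{y \<in> space ?Y. (\<Sum>i<n. (y i)\<^sup>2) < q * s\<^sup>2 * real n}"
    have N [measurable]: "?N \<in> sets ?Y" by measurable
    \<comment> \<open>Off the small-norm event the drift is at least \<open>2 * t\<close>, so only a
      residual deviation of size \<open>t\<close> against the sign of \<open>b j\<close> can cause
      an error.\<close>
    have "bad \<subseteq> E (sgn (b j)) \<union> space ?Z \<times> ?N"
    proof
      fix x assume x: "x \<in> bad"
      obtain z y where zy: "x = (z, y)" by (cases x)
      have W: "z \<in> space ?Z" "y \<in> space ?Y" using x by (auto simp: bad_def zy space_pair_measure)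
      show "x \<in> E (sgn (b j)) \<union> space ?Z \<times> ?N"
      proof (cases "y \<in> ?N")
        case False
        then have "q * s\<^sup>2 * real n \<le> (\<Sum>i<n. (y i)\<^sup>2)" using W by auto
        from beta_hat_support_error[OF t[unfolded t_def] \<tau>s(2) q(1) n \<open>b j \<noteq> 0\<close> _ this, of z j] strong[OF \<open>b j \<noteq> 0\<close>] x
        show ?thesis by (auto simp: bad_def E_def zy t_def)
      qed (use W zy in auto)
    qed
    then have "emeasure ?W bad \<le> emeasure ?W (E (sgn (b j)) \<union> space ?Z \<times> ?N)"
      by (rule emeasure_mono) measurable
    also have "\<dots> \<le> emeasure ?W (E (sgn (b j))) + emeasure ?W (space ?Z \<times> ?N)"
      by (rule emeasure_subadditive) measurable
    also have "emeasure ?W (space ?Z \<times> ?N) = emeasure ?Y ?N"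
      by (subst Y.emeasure_pair_measure_Times) (auto simp: Z.emeasure_space_1)
    also have "emeasure ?W (E (sgn (b j))) + emeasure ?Y ?N \<le>
        ennreal ?c + ennreal (exp (- ((q - 1 - ln q) / 2) * real n))"
      using False by (intro add_mono E gaussian_norm_lower_tail \<tau>s q) (auto simp: sgn_if)
    finally show ?thesis using False by (simp flip: ennreal_plus)
  qed
  finally show ?thesis .
qed

text \<open>Union bound over the columns. Each costs at most
  \<open>2 * exp (- t\<^sup>2 / 2)\<close>, and those in the support also pay for a small response
  norm. The constant \<open>c\<close> is the smaller of the two rates: the excess
  \<open>\<epsilon> / 2\<close> in the squared threshold and the chi-square rate at level
  \<open>q\<close>.\<close>

lemma fixed_signal_error:
  fixes \<epsilon> \<sigma> \<beta> :: real and n p k :: nat and b :: "nat \<Rightarrow> real"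
  defines "q \<equiv> (1 + \<epsilon> / 2) / (1 + \<epsilon>)"
  defines "c \<equiv> min (\<epsilon> / 2) ((q - 1 - ln q) / 2)"
    and "V \<equiv> PiM ({..<n} \<times> {..<p}) (\<lambda>_. gaussian 1) \<Otimes>\<^sub>M PiM {..<n} (\<lambda>_. gaussian \<sigma>)"
  assumes \<epsilon>: "\<epsilon> > 0" and \<sigma>: "\<sigma> > 0" and \<beta>: "\<beta> > 0" and k: "k > 0"
    and card: "card {j. j < p \<and> b j \<noteq> 0} = k"
    and min: "\<And>j. j < p \<Longrightarrow> b j \<noteq> 0 \<Longrightarrow> \<beta> \<le> \<bar>b j\<bar>"
    and n: "real n \<ge> 8 * (1 + \<epsilon>) / \<beta>\<^sup>2 * (l2 p b)\<^sup>2 * ((SNR (l2 p b) \<sigma> + 1) / SNR (l2 p b) \<sigma>) * ln (2 * real p)"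
  shows "emeasure V {(X, w) \<in> space V. \<not> recovers_signed_support \<epsilon> n p X w b} \<le>
    ennreal (real k / real p + 2 * real k * exp (- c * real n) + 1 / real p powr c)"
proof -
  define J where "J = {j. j < p \<and> b j \<noteq> 0}"
  define s where "s = sqrt (\<sigma>\<^sup>2 + (\<Sum>l<p. (b l)\<^sup>2))"
  define t where "t = sqrt (2 * (1 + \<epsilon> / 2) * ln (2 * real p))"
  have J: "finite J" "J \<subseteq> {..<p}" "card J = k" using card by (auto simp: J_def)
  \<comment> \<open>A nonzero entry exists because \<open>k > 0\<close>. It makes \<open>p\<close>
    positive, and also the norm of \<open>b\<close> and hence the SNR, by which the sample size
    condition divides.\<close>
  obtain i where i: "i < p" "b i \<noteq> 0"
    using J k by (auto simp: J_def card_gt_0_iff)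
  then have p: "real p \<ge> 1" by simp
  have q: "0 < q" "q < 1" using \<epsilon> by (auto simp: q_def)
  have s2: "s\<^sup>2 = \<sigma>\<^sup>2 + (\<Sum>l<p. (b l)\<^sup>2)" by (simp add: s_def sum_nonneg)
  then have s: "s\<^sup>2 > 0" using \<sigma> by (auto intro!: add_pos_nonneg sum_nonneg)
  have lnp: "ln (2 * real p) > 0" using p by simp
  have t2: "t\<^sup>2 = 2 * (1 + \<epsilon> / 2) * ln (2 * real p)" and t: "t > 0"
    using \<epsilon> lnp by (auto simp: t_def)
  have r2: "(l2 p b)\<^sup>2 = (\<Sum>l<p. (b l)\<^sup>2)" by (simp add: L2_set_def sum_nonneg)
  have "0 < (b i)\<^sup>2" using i by simp
  also have "\<dots> \<le> (\<Sum>l<p. (b l)\<^sup>2)" using i by (intro member_le_sum) auto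
  finally have "(l2 p b)\<^sup>2 > 0" using r2 by simp
  \<comment> \<open>The SNR factor turns the signal energy into the variance
    \<open>s\<^sup>2\<close> of a response entry.\<close>
  then have "(l2 p b)\<^sup>2 * ((SNR (l2 p b) \<sigma> + 1) / SNR (l2 p b) \<sigma>) = s\<^sup>2"
    using \<sigma> unfolding s2 r2[symmetric] SNR_def by (simp add: field_simps)
  then have n': "8 * (1 + \<epsilon>) / \<beta>\<^sup>2 * s\<^sup>2 * ln (2 * real p) \<le> real n"
    using n by (simp only: mult.assoc)
  moreover have "0 < 8 * (1 + \<epsilon>) / \<beta>\<^sup>2 * s\<^sup>2 * ln (2 * real p)"
    using \<epsilon> \<beta> s lnp by simp
  ultimately have n_pos: "n > 0" by (cases n) auto
  have strong: "4 * t\<^sup>2 \<le> (b j)\<^sup>2 * q * real n / s\<^sup>2" if "j \<in> J" for j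
  proof -
    have "\<beta>\<^sup>2 \<le> \<bar>b j\<bar>\<^sup>2" using that min[of j] \<beta> by (intro power_mono) (auto simp: J_def)
    then have "\<beta>\<^sup>2 * (q * real n / s\<^sup>2) \<le> (b j)\<^sup>2 * (q * real n / s\<^sup>2)"
      using q s by (intro mult_right_mono) auto
    moreover have "4 * t\<^sup>2 \<le> \<beta>\<^sup>2 * (q * real n / s\<^sup>2)"
    proof -
      \<comment> \<open>The choice of \<open>q\<close> gives
        \<open>q * (1 + \<epsilon>) = 1 + \<epsilon> / 2\<close>: the gap between the constants of
        the sample size and of the threshold is spent on the fluctuation of the response
        norm.\<close>
      have "4 * t\<^sup>2 = 8 * (q * (1 + \<epsilon>)) * ln (2 * real p)"
        using \<epsilon> by (simp add: t2 q_def)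
      also have "\<dots> = \<beta>\<^sup>2 * (q * (8 * (1 + \<epsilon>) / \<beta>\<^sup>2 * s\<^sup>2 * ln (2 * real p)) / s\<^sup>2)"
        using \<beta> s by simp
      also have "\<dots> \<le> \<beta>\<^sup>2 * (q * real n / s\<^sup>2)"
        using n' q by (intro mult_left_mono divide_right_mono) auto
      finally show ?thesis .
    qed
    ultimately show ?thesis by (simp add: mult.assoc)
  qed
  let ?e = "exp (- t\<^sup>2 / 2)" and ?d = "exp (- ((q - 1 - ln q) / 2) * real n)"
  let ?bad = "\<lambda>j. {(X, w) \<in> space V. beta_hat \<epsilon> n p X (response p X w b) j \<noteq> sgn (b j)}"
  have bad_sets: "?bad j \<in> sets V" if "j < p" for j
  proof -
    let ?h = "\<lambda>x. beta_hat \<epsilon> n p (fst x) (response p (fst x) (snd x) b) j"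
    have "(\<lambda>x. fst x (i, l)) \<in> borel_measurable V" if "i < n" "l < p" for i l
      unfolding V_def
      by (rule measurable_PiM_borel_component[OF _ sets_PiM_gaussian measurable_fst]) (use that in auto)
    moreover have "(\<lambda>x. snd x i) \<in> borel_measurable V" if "i < n" for i
      unfolding V_def
      by (rule measurable_PiM_borel_component[OF _ sets_PiM_gaussian measurable_snd]) (use that in auto)
    ultimately have "?h \<in> borel_measurable V"
      using that by (intro measurable_beta_hat measurable_response) auto
    then have "{x \<in> space V. ?h x \<noteq> sgn (b j)} \<in> sets V" by measurable
    then show ?thesis by (simp add: case_prod_beta')
  qed
  \<comment> \<open>The threshold is tuned so that the error per column is
    \<open>1 / (2 * real p)\<close> times a further negative power of \<open>2 * real p\<close>; the
    union over the columns leaves that power.\<close>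
  have e: "?e = (2 * real p) powr (- 1 - \<epsilon> / 2)"
    using p by (simp add: t2 powr_def field_simps)
  have c_le: "c \<le> \<epsilon> / 2" "c \<le> (q - 1 - ln q) / 2" unfolding c_def by (rule min.cobounded1, rule min.cobounded2)
  have e2: "2 * real p * ?e \<le> 1 / real p powr c"
  proof -
    have "2 * real p * ?e = (2 * real p) powr (- (\<epsilon> / 2))"
    proof -
      have "(2 * real p) powr (- 1 - \<epsilon> / 2) = (2 * real p) powr (- (\<epsilon> / 2)) / (2 * real p) powr 1"
      proof -
        have "- 1 - \<epsilon> / 2 = - (\<epsilon> / 2) - 1" by simp
        then show ?thesis by (simp only: powr_diff)
      qed
      then show ?thesis unfolding e using p by simp
    qed
    also have "\<dots> \<le> (2 * real p) powr (- c)" using p c_le by (intro powr_mono) auto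
    also have "\<dots> \<le> real p powr (- c)"
    proof (rule powr_mono2')
      show "- c \<le> 0"
        using \<epsilon> q ln_le_minus_one[of q] by (simp add: c_def)
    qed (use p in auto)
    finally show ?thesis by (simp add: powr_minus_divide)
  qed
  have d: "?d \<le> exp (- c * real n)"
    using mult_right_mono[OF c_le(2), of "real n"] by simp
  have "emeasure V {(X, w) \<in> space V. \<not> recovers_signed_support \<epsilon> n p X w b} = emeasure V (\<Union>j<p. ?bad j)"
    by (rule arg_cong[where f = "emeasure V"]) (auto simp: recovers_signed_support_def)
  also have "\<dots> \<le> (\<Sum>j<p. emeasure V (?bad j))"
    using bad_sets by (intro emeasure_subadditive_finite) auto
  also have "\<dots> \<le> (\<Sum>j<p. ennreal (?e + (if b j = 0 then ?e else ?d)))"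
  proof (rule sum_mono)
    fix j assume "j \<in> {..<p}"
    then show "emeasure V (?bad j) \<le> ennreal (?e + (if b j = 0 then ?e else ?d))"
      unfolding V_def t_def
      using strong[of j, unfolded s_def t_def]
      by (intro column_error[OF \<sigma> _ n_pos q t[unfolded t_def]]) (auto simp: J_def)
  qed
  also have "\<dots> = ennreal (\<Sum>j<p. ?e + (if b j = 0 then ?e else ?d))"
    by (intro sum_ennreal) auto
  also have "\<dots> \<le> ennreal (real k / real p + 2 * real k * exp (- c * real n) + 1 / real p powr c)"
  proof (rule ennreal_leI)
    \<comment> \<open>Off the support the summand is \<open>2 * ?e\<close>, on it
      \<open>?e + ?d\<close>, which is at most \<open>2 * ?e + ?d\<close>. The first part is then
      bounded by the power of \<open>p\<close>, the second by the exponential term, and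
      \<open>real k / real p\<close> is nonnegative.\<close>
    have "(\<Sum>j<p. ?e + (if b j = 0 then ?e else ?d)) \<le> (\<Sum>j<p. 2 * ?e + (if j \<in> J then ?d else 0))"
      by (intro sum_mono) (auto simp: J_def)
    also have "\<dots> = 2 * real p * ?e + real k * ?d"
      using J by (simp add: sum.distrib sum.If_cases Int_absorb1 flip: sum.inter_restrict)
    also have "\<dots> \<le> 1 / real p powr c + 2 * real k * exp (- c * real n)"
    proof -
      have "real k * ?d \<le> real k * exp (- c * real n)"
        using d by (intro mult_left_mono) auto
      moreover have "0 \<le> real k * exp (- c * real n)" by simp
      ultimately show ?thesis using e2 by linarith
    qed
    finally show "(\<Sum>j<p. ?e + (if b j = 0 then ?e else ?d)) \<le>
        real k / real p + 2 * real k * exp (- c * real n) + 1 / real p powr c"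
      using p by (smt (verit) divide_nonneg_nonneg of_nat_0_le_iff)
  qed
  finally show ?thesis .
qed

subsection \<open>Averaging over the signal\<close>

text \<open>For a measurable superset of the signals the numerator in the prior equals the
  normalising constant, which is positive and finite, so the quotient is 1. The whole space is one
  such superset, and \<open>P\<close> is a measure by its type.\<close>

lemma signal_prior_prob_space:
  assumes "signal_prior p k D r P"
  shows "prob_space P"
    and "sets P = sets (Pi\<^sub>M {..<p} (\<lambda>_. borel))"
    and "A \<in> sets P \<Longrightarrow> sparse_signals p k D r \<subseteq> A \<Longrightarrow> AE b in P. b \<in> A"
proof -
  let ?S = "sparse_signals p k D r"
  obtain s where sets: "sets P = sets (Pi\<^sub>M {..<p} (\<lambda>_. borel))"
    and S: "0 < hausdorff s p ?S" "hausdorff s p ?S < \<infinity>"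
    and P: "\<And>A. A \<in> sets P \<Longrightarrow> emeasure P A = hausdorff s p (A \<inter> ?S) / hausdorff s p ?S"
    using assms unfolding signal_prior_def uniform_distribution_on_def by blast
  have one: "emeasure P A = 1" if "A \<in> sets P" "?S \<subseteq> A" for A
  proof -
    have "A \<inter> ?S = ?S" using that by auto
    then show ?thesis using P[OF that(1)] S by (simp add: ennreal_divide_self)
  qed
  have "space P = space (Pi\<^sub>M {..<p} (\<lambda>_. borel :: real measure))"
    by (rule sets_eq_imp_space_eq[OF sets])
  then have "?S \<subseteq> space P"
    by (auto simp: sparse_signals_def space_PiM)
  then show "prob_space P"
    using one[of "space P"] by (intro prob_spaceI) auto
  then interpret prob_space P .
  show "AE b in P. b \<in> A" if "A \<in> sets P" "?S \<subseteq> A"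
    using one[OF that] that(1) by (intro AE_prob_1) (simp add: measure_def)
  show "sets P = sets (Pi\<^sub>M {..<p} (\<lambda>_. borel))" by (rule sets)
qed

text \<open>For arbitrary \<open>D\<close> the set of signals need not be measurable; the proof passes to a measurable
  superset.\<close>

lemma AE_signal_prior:
  assumes prior: "signal_prior p k D r P"
  shows "AE b in P. card {j. j < p \<and> b j \<noteq> 0} = k \<and> (\<forall>j<p. b j \<noteq> 0 \<longrightarrow> beta_min D \<le> \<bar>b j\<bar>) \<and> l2 p b = r"
proof -
  have comp: "(\<lambda>b. b j) \<in> borel_measurable P" if "j < p" for j
    using that by (intro measurable_PiM_borel_component[OF _ signal_prior_prob_space(2)[OF prior], of j "\<lambda>b. b"]) auto
  \<comment> \<open>The support size is written as a sum of indicators so that its measurability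
    follows from that of the coordinates.\<close>
  define A where "A = {b \<in> space P. (\<Sum>j<p. if b j \<noteq> 0 then 1 else 0 :: real) = real k \<and>
    (\<forall>j<p. b j \<noteq> 0 \<longrightarrow> beta_min D \<le> \<bar>b j\<bar>) \<and> l2 p b = r}"
  have card: "(\<Sum>j<p. if b j \<noteq> 0 then 1 else 0 :: real) = real (card {j. j < p \<and> b j \<noteq> 0})" for b :: "nat \<Rightarrow> real"
    by (simp add: sum.If_cases Int_def)
  have "A \<in> sets P"
  proof -
    note [measurable] = comp measurable_l2[of p "\<lambda>b. b", OF comp]
    show ?thesis unfolding A_def by measurable
  qed
  moreover have "sparse_signals p k D r \<subseteq> A"
  proof
    fix b assume b: "b \<in> sparse_signals p k D r"
    have "space P = space (Pi\<^sub>M {..<p} (\<lambda>_. borel :: real measure))"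
      by (rule sets_eq_imp_space_eq[OF signal_prior_prob_space(2)[OF prior]])
    then have "b \<in> space P" using b by (auto simp: sparse_signals_def space_PiM)
    moreover have "beta_min D \<le> \<bar>b j\<bar>" if "j < p" "b j \<noteq> 0" for j
      unfolding beta_min_def using b that
      by (intro cInf_lower bdd_belowI[of _ 0]) (auto simp: sparse_signals_def)
    ultimately show "b \<in> A" using b by (simp add: A_def card sparse_signals_def)
  qed
  ultimately have "AE b in P. b \<in> A" by (rule signal_prior_prob_space(3)[OF prior])
  then show ?thesis by (rule AE_mp) (auto simp: A_def card)
qed

text \<open>Tonelli with the third component outermost, to condition on the signal. The triple
  product is nested to the right as in \<open>model\<close>, while the hypothesis concerns the first
  two components jointly, so the iterated integrals are regrouped.\<close>

lemma emeasure_pair_assoc_le: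
  assumes "prob_space L" "prob_space M" "prob_space N" and A: "A \<in> sets (L \<Otimes>\<^sub>M (M \<Otimes>\<^sub>M N))"
    and le: "AE z in N. emeasure (L \<Otimes>\<^sub>M M) {(x, y) \<in> space (L \<Otimes>\<^sub>M M). (x, y, z) \<in> A} \<le> c"
  shows "emeasure (L \<Otimes>\<^sub>M (M \<Otimes>\<^sub>M N)) A \<le> c"
proof -
  interpret L: prob_space L by fact
  interpret M: prob_space M by fact
  interpret N: prob_space N by fact
  interpret LM: pair_prob_space L M ..
  interpret MN: pair_prob_space M N ..
  interpret LMN: pair_prob_space L "M \<Otimes>\<^sub>M N" ..
  let ?f = "\<lambda>y z. emeasure L ((\<lambda>x. (x, y, z)) -` A)"
  have f: "(\<lambda>(y, z). ?f y z) \<in> borel_measurable (M \<Otimes>\<^sub>M N)"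
    using LMN.measurable_emeasure_Pair2[OF A] by (simp add: split_beta')
  have "emeasure (L \<Otimes>\<^sub>M (M \<Otimes>\<^sub>M N)) A = (\<integral>\<^sup>+u. emeasure L ((\<lambda>x. (x, u)) -` A) \<partial>(M \<Otimes>\<^sub>M N))"
    by (rule LMN.emeasure_pair_measure_alt2[OF A])
  also have "\<dots> = (\<integral>\<^sup>+z. \<integral>\<^sup>+y. ?f y z \<partial>M \<partial>N)"
    using MN.nn_integral_snd[OF f] by (simp add: split_beta')
  also have "\<dots> \<le> (\<integral>\<^sup>+z. c \<partial>N)"
  proof (rule nn_integral_mono_AE, rule AE_mp[OF le], rule AE_I2, rule impI)
    fix z assume z: "z \<in> space N"
      and c: "emeasure (L \<Otimes>\<^sub>M M) {(x, y) \<in> space (L \<Otimes>\<^sub>M M). (x, y, z) \<in> A} \<le> c"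
    let ?A = "{(x, y) \<in> space (L \<Otimes>\<^sub>M M). (x, y, z) \<in> A}"
    have "(\<lambda>u. (fst u, snd u, z)) -` A \<inter> space (L \<Otimes>\<^sub>M M) \<in> sets (L \<Otimes>\<^sub>M M)"
      using A z by (intro measurable_sets[of _ _ "L \<Otimes>\<^sub>M (M \<Otimes>\<^sub>M N)"]) auto
    also have "(\<lambda>u. (fst u, snd u, z)) -` A \<inter> space (L \<Otimes>\<^sub>M M) = ?A" by auto
    finally have "?A \<in> sets (L \<Otimes>\<^sub>M M)" .
    then have "emeasure (L \<Otimes>\<^sub>M M) ?A = (\<integral>\<^sup>+y. emeasure L ((\<lambda>x. (x, y)) -` ?A) \<partial>M)"
      by (rule LM.emeasure_pair_measure_alt2)
    also have "\<dots> = (\<integral>\<^sup>+y. ?f y z \<partial>M)"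
      using sets.sets_into_space[OF A]
      by (intro nn_integral_cong arg_cong[where f = "emeasure L"]) (auto simp: space_pair_measure)
    finally show "(\<integral>\<^sup>+y. ?f y z \<partial>M) \<le> c" using c by simp
  qed
  also have "\<dots> = c" by (simp add: N.emeasure_space_1)
  finally show ?thesis .
qed

section \<open>Choice of the constant and conclusion\<close>

theorem theorem2p10:
  fixes \<epsilon> :: real
  assumes "0 < \<epsilon>" and "\<epsilon> < 1"
  shows "\<exists>c\<^sub>2>0. \<forall>(n :: nat \<Rightarrow> nat) (p :: nat \<Rightarrow> nat) (k :: nat \<Rightarrow> nat) (D :: nat \<Rightarrow> real set)
      (r :: nat \<Rightarrow> real) (\<sigma> :: nat \<Rightarrow> real) (P :: nat \<Rightarrow> (nat \<Rightarrow> real) measure).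
    scaling_regime n p k \<and>
    (\<forall>m. 0 < k m \<and> 0 < \<sigma> m \<and>
         beta_min (D m) \<in> abs ` D m \<and> 0 < beta_min (D m) \<and>
         signal_prior (p m) (k m) (D m) (r m) (P m)) \<longrightarrow>
    (\<forall>m. real (n m) \<ge> 8 * (1 + \<epsilon>) / (beta_min (D m))\<^sup>2 * (r m)\<^sup>2
             * ((SNR (r m) (\<sigma> m) + 1) / SNR (r m) (\<sigma> m)) * ln (2 * real (p m)) \<longrightarrow>
       \<P>((X, w, b) in model (n m) (p m) (\<sigma> m) (P m).
            recovers_signed_support \<epsilon> (n m) (p m) X w b)
         \<ge> 1 - (real (k m) / real (p m) + 2 * real (k m) * exp (- c\<^sub>2 * real (n m))
                + 1 / real (p m) powr c\<^sub>2))"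
proof -
  define q where "q = (1 + \<epsilon> / 2) / (1 + \<epsilon>)"
  define c where "c = min (\<epsilon> / 2) ((q - 1 - ln q) / 2)"
  have q: "0 < q" "q < 1" using assms by (auto simp: q_def)
  \<comment> \<open>The inequality is strict because \<open>q\<close> differs from 1, which makes
    the chi-square rate, and so \<open>c\<close>, positive. The constant depends on
    \<open>\<epsilon>\<close> alone.\<close>
  then have "ln q < q - 1" using ln_eq_minus_one[of q] ln_le_minus_one[of q] by fastforce
  then have c: "c > 0" using assms by (simp add: c_def)
  \<comment> \<open>The bound for one choice of dimensions, prior and noise level; it is applied at
    each index \<open>m\<close> of the sequences.\<close>
  have main: "\<P>((X, w, b) in model n p \<sigma> P. recovers_signed_support \<epsilon> n p X w b) \<ge>
      1 - (real k / real p + 2 * real k * exp (- c * real n) + 1 / real p powr c)"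
    if k: "0 < k" and \<sigma>: "0 < \<sigma>" and D: "0 < beta_min D" and prior: "signal_prior p k D r P"
      and n: "real n \<ge> 8 * (1 + \<epsilon>) / (beta_min D)\<^sup>2 * r\<^sup>2 * ((SNR r \<sigma> + 1) / SNR r \<sigma>) * ln (2 * real p)"
    for n p k :: nat and D :: "real set" and r \<sigma> :: real and P
  proof -
    let ?B = "real k / real p + 2 * real k * exp (- c * real n) + 1 / real p powr c"
    let ?X = "PiM ({..<n} \<times> {..<p}) (\<lambda>_. gaussian 1)" and ?W = "PiM {..<n} (\<lambda>_. gaussian \<sigma>)"
    let ?M = "model n p \<sigma> P"
    let ?R = "\<lambda>\<omega>. recovers_signed_support \<epsilon> n p (fst \<omega>) (fst (snd \<omega>)) (snd (snd \<omega>))"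
    let ?A = "{\<omega> \<in> space ?M. \<not> ?R \<omega>}"
    have X: "prob_space ?X" by (intro prob_space_PiM prob_space_gaussian) simp
    have W: "prob_space ?W" using \<sigma> by (intro prob_space_PiM prob_space_gaussian)
    have P: "prob_space P" by (rule signal_prior_prob_space(1)[OF prior])
    interpret X: prob_space ?X by (rule X)
    interpret W: prob_space ?W by (rule W)
    interpret P: prob_space P by (rule P)
    interpret WP: pair_prob_space ?W P ..
    interpret XWP: pair_prob_space ?X "?W \<Otimes>\<^sub>M P" ..
    interpret M: prob_space ?M unfolding model_def by (rule XWP.prob_space_axioms)
    have Xij: "(\<lambda>\<omega>. fst \<omega> (i, j)) \<in> borel_measurable ?M" if "i < n" "j < p" for i j
      unfolding model_def
      by (rule measurable_PiM_borel_component[OF _ sets_PiM_gaussian measurable_fst]) (use that in auto)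
    have wi: "(\<lambda>\<omega>. fst (snd \<omega>) i) \<in> borel_measurable ?M" if "i < n" for i
      unfolding model_def
      by (rule measurable_PiM_borel_component[OF _ sets_PiM_gaussian
            measurable_compose[OF measurable_snd measurable_fst]]) (use that in auto)
    have bj: "(\<lambda>\<omega>. snd (snd \<omega>) j) \<in> borel_measurable ?M" if "j < p" for j
      unfolding model_def
      by (rule measurable_PiM_borel_component[OF _ signal_prior_prob_space(2)[OF prior]
            measurable_compose[OF measurable_snd measurable_snd]]) (use that in auto)
    have R: "Measurable.pred ?M ?R"
    proof -
      have [measurable]: "(\<lambda>\<omega>. beta_hat \<epsilon> n p (fst \<omega>) (response p (fst \<omega>) (fst (snd \<omega>)) (snd (snd \<omega>))) j)
          \<in> borel_measurable ?M" if "j < p" for j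
        using that Xij wi bj by (intro measurable_beta_hat measurable_response) auto
      note bj [measurable]
      show ?thesis unfolding recovers_signed_support_def by measurable
    qed
    then have A: "?A \<in> sets ?M" by measurable
    have "emeasure ?M ?A \<le> ennreal ?B"
      unfolding model_def
    proof (rule emeasure_pair_assoc_le[OF X W P A[unfolded model_def]])
      show "AE b in P. emeasure (?X \<Otimes>\<^sub>M ?W) {(x, w) \<in> space (?X \<Otimes>\<^sub>M ?W).
          (x, w, b) \<in> {\<omega> \<in> space (?X \<Otimes>\<^sub>M (?W \<Otimes>\<^sub>M P)). \<not> ?R \<omega>}} \<le> ennreal ?B"
      \<comment> \<open>For almost every signal the support size, the lower bound on the entries and
        the norm are as prescribed, so \<open>fixed_signal_error\<close> applies with a bound that
        is the same for all of them.\<close>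
      proof (rule AE_mp[OF AE_signal_prior[OF prior]], rule AE_I2, rule impI)
        fix b assume b: "b \<in> space P"
          and good: "card {j. j < p \<and> b j \<noteq> 0} = k \<and> (\<forall>j<p. b j \<noteq> 0 \<longrightarrow> beta_min D \<le> \<bar>b j\<bar>) \<and> l2 p b = r"
        have "{(x, w) \<in> space (?X \<Otimes>\<^sub>M ?W). (x, w, b) \<in> {\<omega> \<in> space (?X \<Otimes>\<^sub>M (?W \<Otimes>\<^sub>M P)). \<not> ?R \<omega>}} =
            {(x, w) \<in> space (?X \<Otimes>\<^sub>M ?W). \<not> recovers_signed_support \<epsilon> n p x w b}"
          using b by (auto simp: space_pair_measure)
        then show "emeasure (?X \<Otimes>\<^sub>M ?W) {(x, w) \<in> space (?X \<Otimes>\<^sub>M ?W).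
            (x, w, b) \<in> {\<omega> \<in> space (?X \<Otimes>\<^sub>M (?W \<Otimes>\<^sub>M P)). \<not> ?R \<omega>}} \<le> ennreal ?B"
          using fixed_signal_error[OF assms(1) \<sigma> D k, of p b n, folded q_def, folded c_def] good n by simp
      qed
    qed
    then have "M.prob ?A \<le> ?B"
      unfolding M.emeasure_eq_measure by (subst (asm) ennreal_le_iff) auto
    moreover have "M.prob {\<omega> \<in> space ?M. ?R \<omega>} = 1 - M.prob ?A"
      using M.prob_neg[OF R[THEN predE]] by simp
    ultimately show ?thesis by (simp add: case_prod_beta')
  qed
  show ?thesis
  proof (intro exI[of _ c] conjI c allI impI, elim conjE)
    fix n p k :: "nat \<Rightarrow> nat" and D :: "nat \<Rightarrow> real set" and r \<sigma> :: "nat \<Rightarrow> real"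
      and P :: "nat \<Rightarrow> (nat \<Rightarrow> real) measure" and m :: nat
    assume "\<forall>m. 0 < k m \<and> 0 < \<sigma> m \<and> beta_min (D m) \<in> abs ` D m \<and> 0 < beta_min (D m) \<and>
        signal_prior (p m) (k m) (D m) (r m) (P m)"
      and n: "real (n m) \<ge> 8 * (1 + \<epsilon>) / (beta_min (D m))\<^sup>2 * (r m)\<^sup>2
             * ((SNR (r m) (\<sigma> m) + 1) / SNR (r m) (\<sigma> m)) * ln (2 * real (p m))"
    then have "0 < k m" "0 < \<sigma> m" "0 < beta_min (D m)"
        "signal_prior (p m) (k m) (D m) (r m) (P m)"
      by blast+
    from main[OF this n]
    show "\<P>((X, w, b) in model (n m) (p m) (\<sigma> m) (P m). recovers_signed_support \<epsilon> (n m) (p m) X w b)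
        \<ge> 1 - (real (k m) / real (p m) + 2 * real (k m) * exp (- c * real (n m)) + 1 / real (p m) powr c)" .
  qed
qed

end
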